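(* Let $g=(A,B,v)\in\mathrm{SU}(2)\times\mathbb{R}$ and let $\arg(A)\in(-\pi,\pi]$. Then: 1. If $A=0$, then $d_2(\mathrm{Id},g)=\sqrt{v^2+\pi^2}$. 2. If $|A|=1$, then $d_2(\mathrm{Id},g)=\sqrt{v^2+4|\arg(A)|(2\pi-|\arg(A)|)}$. 3. If $0<|A|<1$ and $\mathrm{Re}(A)=|A|\sin\bigl(\tfrac{\pi}{2}|A|\bigr)$, then $d_2(\mathrm{Id},g)=\sqrt{v^2+\pi^2(1-|A|^2)}$. 4. If $0<|A|<1$ and $\mathrm{Re}(A)>|A|\sin\bigl(\tfrac{\pi}{2}|A|\bigr)$, then $$d_2(\mathrm{Id},g)=\sqrt{v^2+\frac{4}{1+\xi^2}\Bigl(\sin^{-1}\sqrt{(1-|A|^2)(1+\xi^2)}\Bigr)^2},$$ where $\xi$ is the unique solution of the system $$\cos\Bigl(-\tfrac{\xi}{\sqrt{1+\xi^2}}\sin^{-1}\sqrt{(1-|A|^2)(1+\xi^2)}+\sin^{-1}\tfrac{\xi\sqrt{1-|A|^2}}{|A|}\Bigr)=\tfrac{\mathrm{Re}(A)}{|A|},$$ $$\sin\Bigl(-\tfrac{\xi}{\sqrt{1+\xi^2}}\sin^{-1}\sqrt{(1-|A|^2)(1+\xi^2)}+\sin^{-1}\tfrac{\xi\sqrt{1-|A|^2}}{|A|}\Bigr)=\tfrac{\mathrm{Im}(A)}{|A|}.$$ 5. If $0<|A|<1$ and $\mathrm{Re}(A)<|A|\sin\bigl(\tfrac{\pi}{2}|A|\bigr)$,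 then $$d_2(\mathrm{Id},g)=\sqrt{v^2+\frac{4}{1+\xi^2}\Bigl(\pi-\sin^{-1}\sqrt{(1-|A|^2)(1+\xi^2)}\Bigr)^2},$$ where $\xi$ is the unique solution of the system $$\cos\Bigl(\tfrac{\xi}{\sqrt{1+\xi^2}}\bigl(\pi-\sin^{-1}\sqrt{(1-|A|^2)(1+\xi^2)}\bigr)+\sin^{-1}\tfrac{\xi\sqrt{1-|A|^2}}{|A|}\Bigr)=-\tfrac{\mathrm{Re}(A)}{|A|},$$ $$\sin\Bigl(\tfrac{\xi}{\sqrt{1+\xi^2}}\bigl(\pi-\sin^{-1}\sqrt{(1-|A|^2)(1+\xi^2)}\bigr)+\sin^{-1}\tfrac{\xi\sqrt{1-|A|^2}}{|A|}\Bigr)=\tfrac{\mathrm{Im}(A)}{|A|}.$$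
   Context: $\mathrm{SU}(2)\times\mathbb{R}$ is the group of matrices $(A,B,v)=\begin{pmatrix}A&B&0\\-\overline{B}&\overline{A}&0\\0&0&e^v\end{pmatrix}$, $A,B\in\mathbb{C}$, $|A|^2+|B|^2=1$, $v\in\mathbb{R}$, with identity $\mathrm{Id}$. Let $E_1=\tfrac12(e_{12}-e_{21})$, $E_2=\tfrac{i}{2}(e_{12}+e_{21})$, $E_4=e_{33}$ ($e_{jk}$ the $3\times3$ matrix units). $d_2$ is the left-invariant sub-Riemannian metric defined by the left-invariant distribution with value $\mathrm{span}(E_1,E_4,E_2)$ at $\mathrm{Id}$ and the inner product for which $E_1,E_4,E_2$ are orthonormal. *)

theory Defs
  imports "HOL-Analysis.Analysis"
begin

text \<open>Matrices are elements of complex^3^3; the index type 3 is used with the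
  labels 1, 2, 3 (three pairwise distinct elements of the index type).\<close>

definition munit :: "3 \<Rightarrow> 3 \<Rightarrow> complex^3^3" where
  "munit j k = (\<chi> a b. if a = j \<and> b = k then 1 else 0)"

definition cscale :: "complex \<Rightarrow> complex^3^3 \<Rightarrow> complex^3^3" where
  "cscale c M = (\<chi> a b. c * M $ a $ b)"

definition grp :: "complex \<Rightarrow> complex \<Rightarrow> real \<Rightarrow> complex^3^3" where
  "grp A B v = cscale A (munit 1 1) + cscale B (munit 1 2)
      - cscale (cnj B) (munit 2 1) + cscale (cnj A) (munit 2 2)
      + cscale (complex_of_real (exp v)) (munit 3 3)"

definition SU2R :: "(complex^3^3) set" where
  "SU2R = {grp A B v | A B v. (cmod A)\<^sup>2 + (cmod B)\<^sup>2 = 1}"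

definition Id3 :: "complex^3^3" where
  "Id3 = mat 1"

definition E1 :: "complex^3^3" where
  "E1 = cscale (1/2) (munit 1 2 - munit 2 1)"
definition E2 :: "complex^3^3" where
  "E2 = cscale (\<i>/2) (munit 1 2 + munit 2 1)"
definition E4 :: "complex^3^3" where
  "E4 = munit 3 3"

definition ctrl :: "real \<Rightarrow> real \<Rightarrow> real \<Rightarrow> complex^3^3" where
  "ctrl a b c = a *\<^sub>R E1 + b *\<^sub>R E4 + c *\<^sub>R E2"

text \<open>Horizontal curves on [0,1]: absolutely continuous curves (in integral form)
  with integrable controls, solving gamma' = gamma (u1 E1 + u4 E4 + u2 E2).\<close>
definition horizontal :: "(real \<Rightarrow> complex^3^3) \<Rightarrow> (real \<Rightarrow> real) \<Rightarrow> (real \<Rightarrow> real)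
    \<Rightarrow> (real \<Rightarrow> real) \<Rightarrow> bool" where
  "horizontal \<gamma> u1 u4 u2 \<longleftrightarrow>
     continuous_on {0..1} \<gamma> \<and> (\<forall>t\<in>{0..1}. \<gamma> t \<in> SU2R) \<and>
     u1 absolutely_integrable_on {0..1} \<and> u4 absolutely_integrable_on {0..1} \<and>
     u2 absolutely_integrable_on {0..1} \<and>
     (\<lambda>s. \<gamma> s ** ctrl (u1 s) (u4 s) (u2 s)) integrable_on {0..1} \<and>
     (\<forall>t\<in>{0..1}. \<gamma> t = \<gamma> 0 + integral {0..t} (\<lambda>s. \<gamma> s ** ctrl (u1 s) (u4 s) (u2 s)))"

text \<open>Sub-Riemannian length: E1, E4, E2 orthonormal.\<close>
definition hlength :: "(real \<Rightarrow> real) \<Rightarrow> (real \<Rightarrow> real) \<Rightarrow> (real \<Rightarrow> real) \<Rightarrow> real" where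
  "hlength u1 u4 u2 = integral {0..1} (\<lambda>t. sqrt ((u1 t)\<^sup>2 + (u4 t)\<^sup>2 + (u2 t)\<^sup>2))"

definition d2 :: "complex^3^3 \<Rightarrow> complex^3^3 \<Rightarrow> real" where
  "d2 p q = Inf {hlength u1 u4 u2 | \<gamma> u1 u4 u2.
      horizontal \<gamma> u1 u4 u2 \<and> \<gamma> 0 = p \<and> \<gamma> 1 = q}"

end

theory Submission
  imports Defs
begin

text \<open>
  Write \<open>w = u1 + i u2\<close>. Along a horizontal curve \<open>A' = - B cnj w / 2\<close>, so \<open>|w| = 2 |A'| / sqrt (1 - |A|\<^sup>2)\<close>:
  the SU(2) part of the length is the length of the plane curve \<open>A\<close> for the conformal metric
  \<open>4 |dA|\<^sup>2 / (1 - |A|\<^sup>2)\<close> on the unit disc, while the phase of \<open>B\<close> can be rotated freely.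
  The geodesics issuing from \<open>A = 1\<close> are \<open>geo \<sigma> s = cis (- \<sigma> s) (cos s + i \<sigma> sin s)\<close>, with length
  \<open>2 s sqrt (1 - \<sigma>\<^sup>2)\<close>. In the coordinate \<open>z = cos s + i \<sigma> sin s\<close> they become the modulus preserving map
  \<open>twist\<close>, which acts on each circle \<open>|z| = a\<close> by an increasing circle map; hence \<open>(\<sigma>, s) \<mapsto> geo \<sigma> s\<close> is a
  bijection from \<open>(-1, 1) \<times> (0, pi)\<close> onto the open disc. The resulting function \<open>disc_dist\<close> is differentiable on
  the open disc and solves the eikonal equation, so it calibrates: no curve ending at \<open>A\<close> is shorter than the
  geodesic. Curves touching the boundary circle are handled by replacing \<open>disc_dist A\<close> with
  \<open>disc_dist (\<rho> A)\<close> and letting \<open>\<rho>\<close> tend to 1. The \<open>\<real>\<close>-factor enters through the Cauchy--Schwarz inequality.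
\<close>

section \<open>The twist map of the unit disc\<close>

definition arccos_ratio :: "real \<Rightarrow> real" where
  "arccos_ratio x = arccos x / sqrt (1 - x\<^sup>2)"

text \<open>The derivative R' of R = \<open>arccos_ratio\<close>, in the form of the first-order
  equation (1 - x^2) R' = x R - 1, on which the Jacobian and eikonal computations rest.\<close>

definition arccos_ratio' :: "real \<Rightarrow> real" where
  "arccos_ratio' x = (x * arccos_ratio x - 1) / (1 - x\<^sup>2)"

lemma arccos_ratio_cos: "0 < s \<Longrightarrow> s < pi \<Longrightarrow> arccos_ratio (cos s) = s / sin s"
  by (simp add: arccos_ratio_def arccos_cos cos_squared_eq sin_ge_zero)

lemma mult_cos_less_sin:
  fixes s :: real
  assumes "0 < s" "s < pi"
  shows "s * cos s < sin s"
proof -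
  have "sin 0 - 0 * cos 0 < sin s - s * cos s"
  proof (rule DERIV_pos_imp_increasing_open[OF \<open>0 < s\<close>])
    fix x assume x: "0 < x" "x < s"
    have "((\<lambda>x. sin x - x * cos x) has_real_derivative x * sin x) (at x)"
      by (auto intro!: derivative_eq_intros)
    moreover have "0 < x * sin x"
      using x assms by (simp add: sin_gt_zero)
    ultimately show "\<exists>y. ((\<lambda>x. sin x - x * cos x) has_real_derivative y) (at x) \<and> 0 < y"
      by blast
  qed (intro continuous_intros)
  then show ?thesis by simp
qed

lemma mult_arccos_ratio_less_1:
  assumes "-1 < x" "x < 1"
  shows "x * arccos_ratio x < 1"
proof -
  define s where "s = arccos x"
  have s: "0 < s" "s < pi" "x = cos s"
    using assms arccos_lt_bounded[of x] by (auto simp: s_def cos_arccos)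
  then show ?thesis
    using mult_cos_less_sin[of s] sin_gt_zero[of s] by (simp add: arccos_ratio_cos divide_simps mult.commute)
qed

lemma has_real_derivative_arccos_ratio:
  assumes "-1 < x" "x < 1"
  shows "(arccos_ratio has_real_derivative arccos_ratio' x) (at x)"
proof -
  have p: "0 < 1 - x\<^sup>2"
    using assms by (simp add: abs_square_less_1 abs_less_iff)
  have r: "sqrt (1 - x\<^sup>2) * sqrt (1 - x\<^sup>2) = 1 - x\<^sup>2" "sqrt (1 - x\<^sup>2) \<noteq> 0"
    using p by auto
  show ?thesis
    unfolding arccos_ratio_def
    apply (rule derivative_eq_intros refl | use assms p in force)+
    using r p by (simp add: arccos_ratio'_def arccos_ratio_def field_simps power2_eq_square)
qed

text \<open>With x, y the coordinates of z this is the determinant of \<open>twist' z\<close>, which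
  up to a rotation is the identity minus a rank-one map. The equation for R' factors it as (1 - x R)
  (1 - x^2 - y^2) / (1 - x^2), and every factor is positive in the disc.\<close>

lemma twist_jacobian_pos:
  assumes "x\<^sup>2 + y\<^sup>2 < 1"
  shows "0 < 1 - x * arccos_ratio x + y\<^sup>2 * arccos_ratio' x"
proof -
  have p: "0 < 1 - x\<^sup>2"
    using assms by (smt (verit) zero_le_power2)
  then have "-1 < x" "x < 1"
    by (auto simp: abs_square_less_1 abs_less_iff)
  then have "0 < (1 - x * arccos_ratio x) * (1 - x\<^sup>2 - y\<^sup>2) / (1 - x\<^sup>2)"
    using mult_arccos_ratio_less_1[of x] p assms by simp
  also have "\<dots> = 1 - x * arccos_ratio x + y\<^sup>2 * arccos_ratio' x"
    using p by (simp add: arccos_ratio'_def field_simps)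
  finally show ?thesis .
qed

section \<open>The twist as a family of circle maps\<close>

definition twist :: "complex \<Rightarrow> complex" where
  "twist z = z * cis (- (Im z * arccos_ratio (Re z)))"

definition twist' :: "complex \<Rightarrow> complex \<Rightarrow> complex" where
  "twist' z k = cis (- (Im z * arccos_ratio (Re z))) *
     (k - \<i> * z * of_real (Im k * arccos_ratio (Re z) + Im z * arccos_ratio' (Re z) * Re k))"

lemma cmod_twist [simp]: "cmod (twist z) = cmod z"
  by (simp add: twist_def norm_mult)

lemma Re_bounds_of_disc:
  assumes "cmod z < 1"
  shows "-1 < Re z" "Re z < 1" "(Re z)\<^sup>2 + (Im z)\<^sup>2 < 1"
proof -
  show "(Re z)\<^sup>2 + (Im z)\<^sup>2 < 1"
    using assms by (simp add: cmod_def)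
  show "-1 < Re z" "Re z < 1"
    using assms abs_Re_le_cmod[of z] by auto
qed

lemma has_derivative_arccos_ratio_Re:
  assumes "cmod z < 1"
  shows "((\<lambda>z. arccos_ratio (Re z)) has_derivative (\<lambda>k. arccos_ratio' (Re z) * Re k)) (at z)"
  using has_derivative_compose[OF has_derivative_Re[OF has_derivative_ident]
      has_real_derivative_arccos_ratio[OF Re_bounds_of_disc(1,2)[OF assms], unfolded has_field_derivative_def]]
  by simp

lemma has_derivative_twist:
  assumes "cmod z < 1"
  shows "(twist has_derivative twist' z) (at z)"
  unfolding twist_def
  apply (rule derivative_eq_intros has_derivative_arccos_ratio_Re[OF assms] refl)+
  by (rule ext) (simp add: twist'_def algebra_simps scaleR_conv_of_real)

text \<open>The lift to angles of the action of \<open>twist\<close> on the circle of radius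
  \<open>a\<close>.\<close>

definition phase :: "real \<Rightarrow> real \<Rightarrow> real" where
  "phase a \<eta> = \<eta> - a * sin \<eta> * arccos_ratio (a * cos \<eta>)"

lemma twist_rcis: "twist (rcis a \<eta>) = rcis a (phase a \<eta>)"
  by (simp add: twist_def phase_def rcis_def cis_mult[symmetric] cis_divide cis_mult mult.assoc)

text \<open>Since \<open>twist\<close> preserves moduli, its angular derivative is its whole
  Jacobian, so the positivity already shown applies.\<close>

lemma has_real_derivative_phase:
  assumes "0 \<le> a" "a < 1"
  shows "\<exists>D>0. (phase a has_real_derivative D) (at \<eta>)"
proof -
  have c: "cmod (rcis a \<eta>) < 1" using assms by simp
  note b = Re_bounds_of_disc[OF c]
  have q: "((\<lambda>t. arccos_ratio (a * cos t)) has_real_derivative arccos_ratio' (a * cos \<eta>) * (- a * sin \<eta>)) (at \<eta>)"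
    by (rule DERIV_chain2[OF has_real_derivative_arccos_ratio]) (use b in \<open>auto intro!: derivative_eq_intros\<close>)
  have "(phase a has_real_derivative
      1 - (a * cos \<eta>) * arccos_ratio (a * cos \<eta>) + (a * sin \<eta>)\<^sup>2 * arccos_ratio' (a * cos \<eta>)) (at \<eta>)"
    unfolding phase_def
    apply (rule derivative_eq_intros q refl)+
    by (simp add: algebra_simps power2_eq_square)
  moreover have "0 < 1 - (a * cos \<eta>) * arccos_ratio (a * cos \<eta>) + (a * sin \<eta>)\<^sup>2 * arccos_ratio' (a * cos \<eta>)"
    using twist_jacobian_pos b(3) by simp
  ultimately show ?thesis by blast
qed

lemma phase_strict_mono:
  assumes "0 \<le> a" "a < 1" "\<eta> < \<eta>'"
  shows "phase a \<eta> < phase a \<eta>'"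
  using has_real_derivative_phase[OF assms(1,2)]
  by (intro DERIV_pos_imp_increasing[OF assms(3)]) blast

lemma phase_pi [simp]: "phase a pi = pi" "phase a (- pi) = - pi"
  and phase_0 [simp]: "phase a 0 = 0"
  by (simp_all add: phase_def)

lemma phase_minus: "phase a (- \<eta>) = - phase a \<eta>"
  by (simp add: phase_def)

lemma phase_in_Ioc:
  assumes "0 \<le> a" "a < 1" "- pi < \<eta>" "\<eta> \<le> pi"
  shows "- pi < phase a \<eta>" "phase a \<eta> \<le> pi"
  using phase_strict_mono[OF assms(1,2), of "-pi" \<eta>] phase_strict_mono[OF assms(1,2), of \<eta> pi] assms
  by (cases "\<eta> = pi"; simp)+

lemma Arg_twist:
  assumes "cmod z < 1" "z \<noteq> 0"
  shows "Arg (twist z) = phase (cmod z) (Arg z)"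
proof (rule Arg_unique)
  show "of_real (cmod z) * exp (\<i> * of_real (phase (cmod z) (Arg z))) = twist z"
    using twist_rcis[of "cmod z" "Arg z"] by (metis rcis_cmod_Arg rcis_def cis_conv_exp)
  show "- pi < phase (cmod z) (Arg z)" "phase (cmod z) (Arg z) \<le> pi"
    using phase_in_Ioc[of "cmod z" "Arg z"] assms Arg_bounded[of z] by auto
qed (use assms in auto)

text \<open>Equal images have equal moduli, and on a common circle the strictly increasing
  \<open>phase\<close> separates arguments. The origin is treated apart because its argument carries
  no information.\<close>

lemma inj_on_twist: "inj_on twist (ball 0 1)"
proof (rule inj_onI)
  fix z w assume zw: "z \<in> ball 0 1" "w \<in> ball 0 1" "twist z = twist w"
  then have n: "cmod z = cmod w" by (metis cmod_twist)
  show "z = w"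
  proof (cases "z = 0")
    case True then show ?thesis using n by simp
  next
    case False
    then have "w \<noteq> 0" using n by auto
    then have "phase (cmod z) (Arg z) = phase (cmod z) (Arg w)"
      using Arg_twist[of z] Arg_twist[of w] False zw n by simp
    then have "Arg z = Arg w"
      using phase_strict_mono[of "cmod z" "Arg z" "Arg w"] phase_strict_mono[of "cmod z" "Arg w" "Arg z"] zw
      by (cases "Arg z" "Arg w" rule: linorder_cases) auto
    then show ?thesis using n by (metis rcis_cmod_Arg)
  qed
qed

lemma twist_surj:
  assumes "cmod w < 1"
  obtains z where "cmod z < 1" "twist z = w"
proof -
  \<comment> \<open>On the circle of radius |w| the phase runs from -pi to pi, hence attains
    \<open>Arg w\<close>.\<close>
  have "\<exists>\<eta>\<ge>-pi. \<eta> \<le> pi \<and> phase (cmod w) \<eta> = Arg w"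
  proof (rule IVT)
    show "phase (cmod w) (-pi) \<le> Arg w" "Arg w \<le> phase (cmod w) pi"
      using Arg_bounded[of w] by auto
    show "\<forall>\<eta>. -pi \<le> \<eta> \<and> \<eta> \<le> pi \<longrightarrow> isCont (phase (cmod w)) \<eta>"
      using has_real_derivative_phase[of "cmod w"] assms DERIV_isCont by (metis norm_ge_zero)
  qed simp
  then obtain \<eta> where "phase (cmod w) \<eta> = Arg w" by blast
  then have "twist (rcis (cmod w) \<eta>) = w"
    by (simp add: twist_rcis rcis_cmod_Arg)
  moreover have "cmod (rcis (cmod w) \<eta>) < 1" using assms by simp
  ultimately show ?thesis using that by blast
qed

section \<open>Inverse of the twist and the distance function\<close>

lemma twist'_right_inverse:
  assumes "cmod z < 1"
  obtains g where "twist' z \<circ> g = id" "linear g"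
proof -
  have lin: "linear (twist' z)"
    using has_derivative_twist[OF assms] has_derivative_linear by blast
  have "inj (twist' z)"
  proof (subst linear_injective_0[OF lin], intro allI impI)
    fix k assume "twist' z k = 0"
    \<comment> \<open>A kernel vector must be \<mu> times i z; inserting it into the definition of
      \<mu> leaves \<mu> times the Jacobian equal to 0.\<close>
    define \<mu> where "\<mu> = Im k * arccos_ratio (Re z) + Im z * arccos_ratio' (Re z) * Re k"
    have "k = \<i> * z * of_real \<mu>"
      using \<open>twist' z k = 0\<close> by (simp add: twist'_def \<mu>_def)
    then have k: "Re k = - Im z * \<mu>" "Im k = Re z * \<mu>" by (auto dest: arg_cong[of _ _ Re] arg_cong[of _ _ Im])
    have "\<mu> * (1 - Re z * arccos_ratio (Re z) + (Im z)\<^sup>2 * arccos_ratio' (Re z)) = 0"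
      using \<mu>_def unfolding k by (simp add: algebra_simps power2_eq_square)
    then have "\<mu> = 0"
      using twist_jacobian_pos[OF Re_bounds_of_disc(3)[OF assms]] by simp
    then show "k = 0" using k by (simp add: complex_eq_iff)
  qed
  then obtain g where "linear g" "twist' z \<circ> g = id"
    using linear_injective_isomorphism[OF lin] by (metis comp_def eq_id_iff)
  then show ?thesis using that by blast
qed

definition untwist :: "complex \<Rightarrow> complex" where
  "untwist = inv_into (ball 0 1) twist"

lemma untwist_twist: "cmod z < 1 \<Longrightarrow> untwist (twist z) = z"
  unfolding untwist_def by (rule inv_into_f_f[OF inj_on_twist]) simp

text \<open>For \<open>untwist w\<close> = cos s + i \<sigma> sin s with 0 < s < pi this is the
  geodesic length 2 s sqrt (1 - \<sigma>^2), written in the coordinates of \<open>untwist w\<close>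
  so that it can be differentiated.\<close>

definition disc_dist :: "complex \<Rightarrow> real" where
  "disc_dist w = 2 * arccos_ratio (Re (untwist w)) * sqrt (1 - (cmod (untwist w))\<^sup>2)"

lemma disc_dist_twist: "cmod z < 1 \<Longrightarrow> disc_dist (twist z) = 2 * arccos_ratio (Re z) * sqrt (1 - (cmod z)\<^sup>2)"
  by (simp add: disc_dist_def untwist_twist)

text \<open>The eikonal equation: in the coordinate \<open>z\<close> the differential of the distance is
  \<open>2 / sqrt (1 - |z|\<^sup>2)\<close> times the inner product with the unit vector \<open>- cis (- Im z * arccos_ratio (Re z))\<close>,
  which is the velocity direction of the geodesic through the point.\<close>

lemma has_derivative_disc_dist:
  assumes "cmod w < 1"
  obtains D where "(disc_dist has_derivative D) (at w)"
    "\<And>k. \<bar>D k\<bar> \<le> 2 / sqrt (1 - (cmod w)\<^sup>2) * cmod k"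
proof -
  obtain z where z: "cmod z < 1" "twist z = w" using twist_surj[OF assms] by blast
  obtain g where g: "twist' z \<circ> g = id" "linear g" using twist'_right_inverse[OF z(1)] by blast
  have "(untwist has_derivative g) (at (twist z))"
  proof (rule has_derivative_inverse_strong[where S = "ball 0 1" and f = twist and x = z and f' = "twist' z"])
    show "continuous_on (ball 0 1) twist"
      using has_derivative_twist has_derivative_continuous
      by (metis continuous_at_imp_continuous_on mem_ball_0)
  qed (use z g has_derivative_twist in \<open>auto simp: untwist_twist\<close>)
  then have un: "(untwist has_derivative g) (at w)" using z by simp
  have uw: "untwist w = z" using z untwist_twist by blast
  define b where "b = sqrt (1 - (cmod z)\<^sup>2)"
  have p: "0 < 1 - (cmod z)\<^sup>2" using z by (simp add: power_less_one_iff abs_square_less_1)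
  have b: "0 < b" "b\<^sup>2 = 1 - (cmod z)\<^sup>2" using p by (auto simp: b_def)
  \<comment> \<open>The candidate differential at \<open>z\<close>. Its second factor is the real
    part of the bracket in \<open>twist' z k\<close>, so composing with the inverse \<open>g\<close>
    leaves the real part of a rotated vector.\<close>
  define G where "G = (\<lambda>k. - (2 / b) * (Re k + Im z * (Im k * arccos_ratio (Re z) + Im z * arccos_ratio' (Re z) * Re k)))"
  have n: "(cmod z)\<^sup>2 = (Re z)\<^sup>2 + (Im z)\<^sup>2" by (simp add: cmod_power2)
  have sq: "((\<lambda>z. sqrt (1 - ((Re z)\<^sup>2 + (Im z)\<^sup>2))) has_derivative
      (\<lambda>k. - (Re z * Re k + Im z * Im k) / b)) (at z)"
    apply (rule derivative_eq_intros refl | use p n in force)+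
    by (rule ext) (use b n in \<open>simp add: b_def field_simps\<close>)
  have "((\<lambda>z. 2 * arccos_ratio (Re z) * sqrt (1 - ((Re z)\<^sup>2 + (Im z)\<^sup>2))) has_derivative
      (\<lambda>k. 2 * arccos_ratio (Re z) * (- (Re z * Re k + Im z * Im k) / b) + 2 * (arccos_ratio' (Re z) * Re k) * b)) (at z)"
    using has_derivative_mult[OF has_derivative_mult_right[OF has_derivative_arccos_ratio_Re[OF z(1)], of 2] sq]
    unfolding b_def n .
  moreover have "2 * arccos_ratio (Re z) * (- (Re z * Re k + Im z * Im k) / b) + 2 * (arccos_ratio' (Re z) * Re k) * b = G k" for k
  proof -
    have "1 - (Re z)\<^sup>2 \<noteq> 0" using p n by (smt (verit) zero_le_power2)
    then have "arccos_ratio' (Re z) * (1 - (Re z)\<^sup>2) = Re z * arccos_ratio (Re z) - 1" by (simp add: arccos_ratio'_def)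
    then have "arccos_ratio' (Re z) * b\<^sup>2 = Re z * arccos_ratio (Re z) - 1 - arccos_ratio' (Re z) * (Im z)\<^sup>2"
      unfolding b(2) n by (simp add: algebra_simps)
    then have e: "2 * (arccos_ratio' (Re z) * Re k) * b * b = 2 * Re k * (Re z * arccos_ratio (Re z) - 1 - arccos_ratio' (Re z) * (Im z)\<^sup>2)"
      by (metis (no_types, opaque_lifting) mult.assoc mult.commute power2_eq_square)
    \<comment> \<open>Multiplying by \<open>b\<close> clears the square root; the resulting b^2 R'
      has been eliminated in \<open>e\<close> through (1 - x^2) R' = x R - 1.\<close>
    have "(2 * arccos_ratio (Re z) * (- (Re z * Re k + Im z * Im k) / b) + 2 * (arccos_ratio' (Re z) * Re k) * b) * b =
        - (2 * arccos_ratio (Re z) * (Re z * Re k + Im z * Im k)) + 2 * (arccos_ratio' (Re z) * Re k) * b * b"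
      using b(1) by (simp add: field_simps)
    also have "\<dots> = G k * b"
      unfolding e using b(1) by (simp add: G_def field_simps power2_eq_square)
    finally show ?thesis using b(1) by simp
  qed
  ultimately have "((\<lambda>z. 2 * arccos_ratio (Re z) * sqrt (1 - ((Re z)\<^sup>2 + (Im z)\<^sup>2))) has_derivative G) (at z)"
    by simp
  then have der: "((\<lambda>z. 2 * arccos_ratio (Re z) * sqrt (1 - (cmod z)\<^sup>2)) has_derivative G) (at z)"
    by (simp add: cmod_power2)
  have "(disc_dist has_derivative (\<lambda>k. G (g k))) (at w)"
    unfolding disc_dist_def
    using has_derivative_compose[OF un] der uw by simp
  moreover have "\<bar>G (g k)\<bar> \<le> 2 / sqrt (1 - (cmod w)\<^sup>2) * cmod k" for k
  proof -
    have "k = twist' z (g k)" using g by (metis comp_apply id_apply)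
    then have "cis (Im z * arccos_ratio (Re z)) * k = g k - \<i> * z * of_real (Im (g k) * arccos_ratio (Re z) + Im z * arccos_ratio' (Re z) * Re (g k))"
      unfolding twist'_def by (metis (no_types, lifting) cis_mult cis_zero mult.assoc mult.left_neutral add.right_inverse)
    then have "G (g k) = - (2 / b) * Re (cis (Im z * arccos_ratio (Re z)) * k)"
      by (simp add: G_def)
    then have "\<bar>G (g k)\<bar> = 2 / b * \<bar>Re (cis (Im z * arccos_ratio (Re z)) * k)\<bar>"
      using b by (simp add: abs_mult del: times_complex.simps)
    also have "\<dots> \<le> 2 / b * cmod (cis (Im z * arccos_ratio (Re z)) * k)"
      using b by (intro mult_left_mono abs_Re_le_cmod) auto
    also have "\<dots> = 2 / sqrt (1 - (cmod w)\<^sup>2) * cmod k"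
      using z by (auto simp: norm_mult b_def)
    finally show ?thesis .
  qed
  ultimately show ?thesis using that by blast
qed

section \<open>Geodesics and a calibration inequality\<close>

definition geo :: "real \<Rightarrow> real \<Rightarrow> complex" where
  "geo \<sigma> s = cis (- (\<sigma> * s)) * Complex (cos s) (\<sigma> * sin s)"

lemma geo_eq_twist:
  assumes "0 < s" "s < pi"
  shows "geo \<sigma> s = twist (Complex (cos s) (\<sigma> * sin s))"
  using assms sin_gt_zero[of s] by (simp add: geo_def twist_def arccos_ratio_cos mult.commute)

lemma cmod_geo: "(cmod (geo \<sigma> s))\<^sup>2 = 1 - (1 - \<sigma>\<^sup>2) * (sin s)\<^sup>2"
proof -
  have "(cmod (geo \<sigma> s))\<^sup>2 = (cos s)\<^sup>2 + (\<sigma> * sin s)\<^sup>2"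
    by (simp add: geo_def norm_mult cmod_power2)
  then show ?thesis by (simp add: cos_squared_eq algebra_simps power_mult_distrib)
qed

lemma cmod_geo_Complex: "cmod (Complex (cos s) (\<sigma> * sin s)) = cmod (geo \<sigma> s)"
  by (simp add: geo_def norm_mult)

lemma cmod_geo_less_1:
  assumes "\<bar>\<sigma>\<bar> < 1" "0 < s" "s < pi"
  shows "cmod (geo \<sigma> s) < 1"
proof -
  have "0 < (1 - \<sigma>\<^sup>2) * (sin s)\<^sup>2"
    using assms sin_gt_zero[of s] by (simp add: abs_square_less_1)
  then have "(cmod (geo \<sigma> s))\<^sup>2 < 1\<^sup>2" by (simp add: cmod_geo)
  then show ?thesis by (rule power_less_imp_less_base) simp
qed

lemma disc_dist_geo:
  assumes "\<bar>\<sigma>\<bar> < 1" "0 < s" "s < pi"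
  shows "disc_dist (geo \<sigma> s) = 2 * s * sqrt (1 - \<sigma>\<^sup>2)"
proof -
  have "sin s > 0" using assms by (simp add: sin_gt_zero)
  moreover have "cmod (Complex (cos s) (\<sigma> * sin s)) < 1"
    using cmod_geo_less_1[OF assms] by (simp add: cmod_geo_Complex)
  ultimately have "disc_dist (geo \<sigma> s) = 2 * (s / sin s) * sqrt (1 - (cmod (geo \<sigma> s))\<^sup>2)"
    unfolding geo_eq_twist[OF assms(2,3)]
    by (subst disc_dist_twist) (simp_all add: arccos_ratio_cos[OF assms(2,3)])
  also have "\<dots> = 2 * s * sqrt (1 - \<sigma>\<^sup>2)"
    using \<open>sin s > 0\<close> by (simp add: cmod_geo real_sqrt_mult)
  finally show ?thesis .
qed

text \<open>In the untwisted coordinate z the parameters are explicit: s = arccos (Re z) and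
  \<sigma> = Im z / sin s, where |z| < 1 amounts to |\<sigma>| < 1.\<close>

lemma geo_surj:
  assumes "cmod A < 1"
  obtains \<sigma> s where "\<bar>\<sigma>\<bar> < 1" "0 < s" "s < pi" "A = geo \<sigma> s"
proof -
  obtain z where z: "cmod z < 1" "twist z = A" using twist_surj[OF assms] by blast
  note b = Re_bounds_of_disc[OF z(1)]
  define s where "s = arccos (Re z)"
  have s: "0 < s" "s < pi" "cos s = Re z"
    using b arccos_lt_bounded[of "Re z"] by (auto simp: s_def)
  have sp: "0 < sin s" using s by (simp add: sin_gt_zero)
  have "(Im z)\<^sup>2 < (sin s)\<^sup>2" using b(3) s(3) by (simp add: sin_squared_eq)
  then have "(Im z / sin s)\<^sup>2 < 1" using sp by (simp add: power_divide)
  then have "\<bar>Im z / sin s\<bar> < 1" by (simp add: abs_square_less_1)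
  moreover have "Complex (cos s) (Im z / sin s * sin s) = z" using sp s by (simp add: complex_eq_iff)
  then have "A = geo (Im z / sin s) s" using geo_eq_twist[OF s(1,2)] z by simp
  ultimately show ?thesis using that s by blast
qed

lemma geo_inj:
  assumes "\<bar>\<sigma>\<bar> < 1" "0 < s" "s < pi" "\<bar>\<sigma>'\<bar> < 1" "0 < s'" "s' < pi" "geo \<sigma> s = geo \<sigma>' s'"
  shows "\<sigma> = \<sigma>'" "s = s'"
proof -
  have "Complex (cos s) (\<sigma> * sin s) = Complex (cos s') (\<sigma>' * sin s')"
  proof (rule inj_onD[OF inj_on_twist])
    show "twist (Complex (cos s) (\<sigma> * sin s)) = twist (Complex (cos s') (\<sigma>' * sin s'))"
      using assms by (simp add: geo_eq_twist)
  qed (use assms cmod_geo_less_1 in \<open>auto simp: cmod_geo_Complex\<close>)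
  then have e: "cos s = cos s'" "\<sigma> * sin s = \<sigma>' * sin s'" by auto
  then show "s = s'" using cos_inj_pi[of s s'] assms by auto
  then show "\<sigma> = \<sigma>'" using e sin_gt_zero[of s] assms by auto
qed

text \<open>A calibration inequality for curves that are only indefinite integrals. As
  \<open>c\<close> need not be differentiable everywhere, the chain rule along it is avoided: the
  estimate with factor 1 + e is proved on short intervals, glued by the Bolzano principle, and then
  e tends to 0.\<close>

lemma abs_diff_along_curve_le:
  fixes c g :: "real \<Rightarrow> 'a::euclidean_space" and \<phi> :: "'a \<Rightarrow> real" and k m :: "real \<Rightarrow> real"
  assumes c: "\<And>t. t \<in> {0..1} \<Longrightarrow> c t = c 0 + integral {0..t} g"
    and g: "g integrable_on {0..1}" and m: "m integrable_on {0..1}" "\<And>t. t \<in> {0..1} \<Longrightarrow> 0 \<le> m t"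
    and k: "continuous_on {0..1} k" "\<And>t. t \<in> {0..1} \<Longrightarrow> 0 \<le> k t"
    and bound: "\<And>t. t \<in> {0..1} \<Longrightarrow> norm (g t) \<le> k t * m t"
    and der: "\<And>t. t \<in> {0..1} \<Longrightarrow> \<exists>D K. (\<phi> has_derivative D) (at (c t)) \<and> 0 \<le> K \<and>
                (\<forall>h. \<bar>D h\<bar> \<le> K * norm h) \<and> K * k t \<le> 1"
  shows "\<bar>\<phi> (c 1) - \<phi> (c 0)\<bar> \<le> integral {0..1} m"
proof -
  have sub: "f integrable_on {a..b}" if "f integrable_on {0..1}" "0 \<le> a" "b \<le> 1"
    for f :: "real \<Rightarrow> 'b::euclidean_space" and a b
    using that integrable_on_subinterval[of f "{0..1}"] by auto
  have cdiff: "c b - c a = integral {a..b} g" if "0 \<le> a" "a \<le> b" "b \<le> 1" for a b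
    using that c[of a] c[of b] Henstock_Kurzweil_Integration.integral_combine[of 0 a b g] sub[OF g, of 0 b]
    by (auto simp: algebra_simps)
  have contc: "continuous_on {0..1} c"
  proof -
    have "continuous_on {0..1} (\<lambda>t. c 0 + integral {0..t} g)"
      by (intro continuous_intros indefinite_integral_continuous_1 g)
    then show ?thesis using c by (metis (no_types, lifting) continuous_on_cong)
  qed
  have main: "\<bar>\<phi> (c 1) - \<phi> (c 0)\<bar> \<le> (1 + e) * integral {0..1} m" if e: "e > 0" for e
  proof -
    \<comment> \<open>The guard is built in because the local hypothesis of the Bolzano principle
      also ranges over intervals that leave [0, 1].\<close>
    define P where "P = (\<lambda>a b. 0 \<le> a \<and> b \<le> 1 \<longrightarrow> \<bar>\<phi> (c b) - \<phi> (c a)\<bar> \<le> (1 + e) * integral {a..b} m)"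
    have mcomb: "integral {a..b} m + integral {b..d} m = integral {a..d} m"
      if "0 \<le> a" "a \<le> b" "b \<le> d" "d \<le> 1" for a b d
      using that Henstock_Kurzweil_Integration.integral_combine[of a b d m] sub[OF m(1), of a d] by auto
    have "(0::real) \<le> 1" by simp
    then have "P 0 1"
    proof (induction rule: Bolzano)
      case (trans a b d)
      show ?case unfolding P_def
      proof (intro impI)
        assume ad: "0 \<le> a \<and> d \<le> 1"
        have "\<bar>\<phi> (c d) - \<phi> (c a)\<bar> \<le> \<bar>\<phi> (c d) - \<phi> (c b)\<bar> + \<bar>\<phi> (c b) - \<phi> (c a)\<bar>" by linarith
        also have "\<dots> \<le> (1 + e) * integral {b..d} m + (1 + e) * integral {a..b} m"
          using trans ad unfolding P_def by (intro add_mono) auto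
        also have "\<dots> = (1 + e) * integral {a..d} m"
          using mcomb[of a b d] trans ad by (simp add: distrib_left[symmetric] add.commute)
        finally show "\<bar>\<phi> (c d) - \<phi> (c a)\<bar> \<le> (1 + e) * integral {a..d} m" .
      qed
    next
      case (local x)
      then have x: "x \<in> {0..1}" by auto
      obtain D K where D: "(\<phi> has_derivative D) (at (c x))" "0 \<le> K"
        "\<And>h. \<bar>D h\<bar> \<le> K * norm h" "K * k x \<le> 1"
        using der[OF x] by blast
      \<comment> \<open>Small enough to turn \<open>K * k x \<le> 1\<close> into the strict bound 1
        + e for \<open>(K + \<delta>) * k x\<close>; the added 1 covers \<open>k x = 0\<close>.
        Continuity of \<open>k\<close> then spreads the bound to a neighbourhood.\<close>
      define \<delta> where "\<delta> = e / (2 * (k x + 1))"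
      have kx: "0 \<le> k x" using k x by blast
      have \<delta>: "0 < \<delta>" using e kx by (simp add: \<delta>_def)
      have "\<delta> * k x \<le> e / 2"
        using e kx by (simp add: \<delta>_def field_simps)
      then have Kk: "(K + \<delta>) * k x < 1 + e"
        using D e by (simp add: algebra_simps)
      obtain d1 where d1: "d1 > 0"
        "\<And>y. norm (y - c x) < d1 \<Longrightarrow> norm (\<phi> y - \<phi> (c x) - D (y - c x)) \<le> \<delta> * norm (y - c x)"
        using D(1) \<delta> unfolding has_derivative_at_alt by blast
      have lip: "\<bar>\<phi> y - \<phi> (c x)\<bar> \<le> (K + \<delta>) * norm (y - c x)" if "norm (y - c x) < d1" for y
        using d1(2)[OF that] D(3)[of "y - c x"] by (simp add: distrib_right)
      obtain d2 where d2: "d2 > 0" "\<And>y. y \<in> {0..1} \<Longrightarrow> dist y x < d2 \<Longrightarrow> dist (c y) (c x) < d1"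
        using contc d1(1) x unfolding continuous_on_iff by metis
      have "continuous_on {0..1} (\<lambda>t. (K + \<delta>) * k t)" by (intro continuous_intros k)
      then obtain d3 where d3: "d3 > 0"
        "\<And>y. y \<in> {0..1} \<Longrightarrow> dist y x < d3 \<Longrightarrow> dist ((K + \<delta>) * k y) ((K + \<delta>) * k x) < 1 + e - (K + \<delta>) * k x"
        using Kk x unfolding continuous_on_iff by (metis diff_gt_0_iff_gt)
      have step: "(K + \<delta>) * norm (integral {a..b} g) \<le> (1 + e) * integral {a..b} m"
        if ab: "0 \<le> a" "a \<le> x" "x \<le> b" "b \<le> 1" "b - a < d3" for a b
      proof -
        have "norm (integral {a..b} (\<lambda>t. (K + \<delta>) *\<^sub>R g t)) \<le> integral {a..b} (\<lambda>t. (1 + e) *\<^sub>R m t)"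
        proof (rule integral_norm_bound_integral)
          show "(\<lambda>t. (K + \<delta>) *\<^sub>R g t) integrable_on {a..b}" "(\<lambda>t. (1 + e) *\<^sub>R m t) integrable_on {a..b}"
            using ab sub[OF g, of a b] sub[OF m(1), of a b] integrable_cmul by blast+
          fix t assume t: "t \<in> {a..b}"
          then have t1: "t \<in> {0..1}" "dist t x < d3" using ab by (auto simp: dist_real_def)
          have "(K + \<delta>) * k t \<le> 1 + e" using d3(2)[OF t1] by (simp add: dist_real_def)
          then have "((K + \<delta>) * k t) * m t \<le> (1 + e) * m t"
            using m(2)[OF t1(1)] by (rule mult_right_mono)
          moreover have "(K + \<delta>) * norm (g t) \<le> (K + \<delta>) * (k t * m t)"
            using bound[OF t1(1)] D(2) \<delta> by (intro mult_left_mono) auto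
          ultimately have "(K + \<delta>) * norm (g t) \<le> (1 + e) * m t"
            by (simp only: mult.assoc)
          then show "norm ((K + \<delta>) *\<^sub>R g t) \<le> (1 + e) *\<^sub>R m t"
            using D(2) \<delta> by simp
        qed
        then show ?thesis using D(2) \<delta> by simp
      qed
      show ?case
      proof (intro exI[of _ "min d2 d3"] conjI allI impI)
        show "0 < min d2 d3" using d2 d3 by simp
        fix a b assume ab: "a \<le> x \<and> x \<le> b \<and> b - a < min d2 d3"
        show "P a b" unfolding P_def
        proof (intro impI)
          assume ab2: "0 \<le> a \<and> b \<le> 1"
          \<comment> \<open>The local Lipschitz bound is centred at \<open>c x\<close>, so the
            increment over [a, b] is cut at \<open>x\<close>.\<close>
          have "\<bar>\<phi> (c b) - \<phi> (c x)\<bar> \<le> (K + \<delta>) * norm (c b - c x)"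
            using d2(2)[of b] ab ab2 by (intro lip) (auto simp: dist_norm)
          also have "c b - c x = integral {x..b} g" using cdiff ab ab2 by auto
          also have "(K + \<delta>) * norm \<dots> \<le> (1 + e) * integral {x..b} m" using step[of x b] ab ab2 x by auto
          finally have 1: "\<bar>\<phi> (c b) - \<phi> (c x)\<bar> \<le> (1 + e) * integral {x..b} m" .
          have "\<bar>\<phi> (c a) - \<phi> (c x)\<bar> \<le> (K + \<delta>) * norm (c a - c x)"
            using d2(2)[of a] ab ab2 by (intro lip) (auto simp: dist_norm)
          also have "norm (c a - c x) = norm (integral {a..x} g)"
            using cdiff[of a x] ab ab2 by (metis atLeastAtMost_iff norm_minus_commute x)
          also have "(K + \<delta>) * \<dots> \<le> (1 + e) * integral {a..x} m" using step[of a x] ab ab2 x by auto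
          finally have 2: "\<bar>\<phi> (c a) - \<phi> (c x)\<bar> \<le> (1 + e) * integral {a..x} m" .
          have "\<bar>\<phi> (c b) - \<phi> (c a)\<bar> \<le> (1 + e) * (integral {a..x} m + integral {x..b} m)"
            using 1 2 by (simp add: distrib_left)
          then show "\<bar>\<phi> (c b) - \<phi> (c a)\<bar> \<le> (1 + e) * integral {a..b} m"
            using mcomb[of a x b] ab ab2 by auto
        qed
      qed
    qed
    then show ?thesis unfolding P_def by auto
  qed
  show ?thesis
  proof (rule field_le_epsilon)
    fix e :: real assume e: "e > 0"
    define I where "I = integral {0..1} m"
    have I: "I \<ge> 0" unfolding I_def using m by (intro integral_nonneg) auto
    have "\<bar>\<phi> (c 1) - \<phi> (c 0)\<bar> \<le> (1 + e / (I + 1)) * I"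
      unfolding I_def[symmetric] using main[of "e / (I + 1)"] e I by (simp add: I_def)
    also have "\<dots> \<le> I + e" using e I by (simp add: field_simps)
    finally show "\<bar>\<phi> (c 1) - \<phi> (c 0)\<bar> \<le> integral {0..1} m + e" by (simp add: I_def)
  qed
qed

section \<open>Lower bounds for horizontal curves\<close>

text \<open>\<open>grp\<close> with its last entry freed from the exponential. This makes it real
  linear, so velocities of curves in the group have the same form as points.\<close>

definition emb :: "complex \<times> complex \<times> complex \<Rightarrow> complex^3^3" where
  "emb = (\<lambda>(A, B, E). cscale A (munit 1 1) + cscale B (munit 1 2)
      - cscale (cnj B) (munit 2 1) + cscale (cnj A) (munit 2 2) + cscale E (munit 3 3))"

lemma linear_emb: "linear emb"
  by (rule linearI)
     (auto simp: emb_def cscale_def munit_def vec_eq_iff complex_eq_iff algebra_simps)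

lemma grp_eq_emb: "grp A B v = emb (A, B, complex_of_real (exp v))"
  by (simp add: grp_def emb_def)

lemma emb_nth:
  "emb (A, B, E) $ 1 $ 1 = A" "emb (A, B, E) $ 1 $ 2 = B" "emb (A, B, E) $ 3 $ 3 = E"
  by (simp_all add: emb_def cscale_def munit_def)

text \<open>With w = a + i c this is the control system A' = - B cnj w / 2, B' = A w / 2, E' = E b;
  the equations of the two factors of the group decouple.\<close>

lemma emb_mult_ctrl:
  "emb (A, B, E) ** ctrl a b c =
     emb (- (B * cnj (Complex a c) / 2), A * Complex a c / 2, E * of_real b)"
  by (simp add: vec_eq_iff forall_3 matrix_matrix_mult_def sum_3 emb_def ctrl_def E1_def E2_def E4_def
      cscale_def munit_def complex_eq_iff field_simps)

lemma Id3_eq_grp: "Id3 = grp 1 0 0"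
  by (simp add: Id3_def grp_eq_emb vec_eq_iff forall_3 emb_def cscale_def munit_def mat_def)

text \<open>Both integrands are norms of vector-valued linear combinations of the controls, and
  absolute integrability survives such combinations and norms.\<close>

lemma absolutely_integrable_control_norms:
  fixes u1 u4 u2 :: "real \<Rightarrow> real"
  assumes "u1 absolutely_integrable_on S" "u4 absolutely_integrable_on S" "u2 absolutely_integrable_on S"
  shows "(\<lambda>t. cmod (Complex (u1 t) (u2 t))) integrable_on S"
    "(\<lambda>t. sqrt ((u1 t)\<^sup>2 + (u4 t)\<^sup>2 + (u2 t)\<^sup>2)) integrable_on S"
proof -
  have lin: "(\<lambda>t. u t *\<^sub>R x) absolutely_integrable_on S" if "u absolutely_integrable_on S"
    for u :: "real \<Rightarrow> real" and x :: "'b::euclidean_space"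
    using absolutely_integrable_linear[OF that bounded_linear_scaleR_left[of x]] by (simp add: o_def)
  have "(\<lambda>t. norm (u1 t *\<^sub>R (1::complex) + u2 t *\<^sub>R \<i>)) absolutely_integrable_on S"
    by (intro absolutely_integrable_norm[unfolded o_def] set_integral_add lin assms)
  moreover have "norm (u1 t *\<^sub>R (1::complex) + u2 t *\<^sub>R \<i>) = cmod (Complex (u1 t) (u2 t))" for t
    by (simp add: cmod_def)
  ultimately show "(\<lambda>t. cmod (Complex (u1 t) (u2 t))) integrable_on S"
    using set_lebesgue_integral_eq_integral(1) by auto
  have "(\<lambda>t. norm (u1 t *\<^sub>R (1::complex, 0::real) + u4 t *\<^sub>R (0, 1) + u2 t *\<^sub>R (\<i>, 0))) absolutely_integrable_on S"
    by (intro absolutely_integrable_norm[unfolded o_def] set_integral_add lin assms)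
  moreover have "norm (u1 t *\<^sub>R (1::complex, 0::real) + u4 t *\<^sub>R (0, 1) + u2 t *\<^sub>R (\<i>, 0)) =
      sqrt ((u1 t)\<^sup>2 + (u4 t)\<^sup>2 + (u2 t)\<^sup>2)" for t
    by (simp add: norm_prod_def cmod_def)
  ultimately show "(\<lambda>t. sqrt ((u1 t)\<^sup>2 + (u4 t)\<^sup>2 + (u2 t)\<^sup>2)) integrable_on S"
    using set_lebesgue_integral_eq_integral(1) by auto
qed

text \<open>Matrix entries are bounded linear maps and commute with the integral, so the matrix
  equation yields scalar integral equations for \<open>A\<close> and \<open>E\<close>.\<close>

lemma horizontal_coordinates:
  assumes hor: "horizontal \<gamma> u1 u4 u2" and end0: "\<gamma> 0 = Id3" and end1: "\<gamma> 1 = grp A1 B1 v1"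
  obtains A B E where
    "continuous_on {0..1} A" "continuous_on {0..1} B" "continuous_on {0..1} E"
    "\<And>t. t \<in> {0..1} \<Longrightarrow> (cmod (A t))\<^sup>2 + (cmod (B t))\<^sup>2 = 1"
    "\<And>t. t \<in> {0..1} \<Longrightarrow> 0 < E t"
    "A 0 = 1" "A 1 = A1" "E 0 = 1" "E 1 = exp v1"
    "(\<lambda>t. - (B t * cnj (Complex (u1 t) (u2 t)) / 2)) integrable_on {0..1}"
    "(\<lambda>t. E t * u4 t) integrable_on {0..1}"
    "\<And>t. t \<in> {0..1} \<Longrightarrow> A t = A 0 + integral {0..t} (\<lambda>t. - (B t * cnj (Complex (u1 t) (u2 t)) / 2))"
    "\<And>t. t \<in> {0..1} \<Longrightarrow> E t = E 0 + integral {0..t} (\<lambda>t. E t * u4 t)"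
proof -
  define A where "A = (\<lambda>t. \<gamma> t $ 1 $ 1)"
  define B where "B = (\<lambda>t. \<gamma> t $ 1 $ 2)"
  define E where "E = (\<lambda>t. Re (\<gamma> t $ 3 $ 3))"
  define X where "X = (\<lambda>s. \<gamma> s ** ctrl (u1 s) (u4 s) (u2 s))"
  have X: "X integrable_on {0..1}" "\<And>t. t \<in> {0..1} \<Longrightarrow> \<gamma> t = \<gamma> 0 + integral {0..t} X"
    and cont: "continuous_on {0..1} \<gamma>" and inS: "\<And>t. t \<in> {0..1} \<Longrightarrow> \<gamma> t \<in> SU2R"
    using hor unfolding horizontal_def X_def by blast+
  have coord: "(cmod (A t))\<^sup>2 + (cmod (B t))\<^sup>2 = 1 \<and> 0 < E t \<and> \<gamma> t = emb (A t, B t, of_real (E t))"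
    if t: "t \<in> {0..1}" for t
  proof -
    obtain a b v where "\<gamma> t = grp a b v" "(cmod a)\<^sup>2 + (cmod b)\<^sup>2 = 1"
      using inS[OF t] unfolding SU2R_def by blast
    then show ?thesis by (simp add: A_def B_def E_def grp_eq_emb emb_nth)
  qed
  have Xt: "X t = emb (- (B t * cnj (Complex (u1 t) (u2 t)) / 2), A t * Complex (u1 t) (u2 t) / 2, of_real (E t * u4 t))"
    if t: "t \<in> {0..1}" for t
    using coord[OF t] emb_mult_ctrl[of "A t" "B t" "of_real (E t)"] by (simp add: X_def)
  have bl: "bounded_linear (\<lambda>M::complex^3^3. M $ 1 $ 1)" "bounded_linear (\<lambda>M::complex^3^3. Re (M $ 3 $ 3))"
    by (intro bounded_linear_compose[OF bounded_linear_vec_nth] bounded_linear_compose[OF bounded_linear_Re] bounded_linear_vec_nth)+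
  have tr: "(\<lambda>t. h (X t)) integrable_on {0..1} \<and> (\<forall>t\<in>{0..1}. h (\<gamma> t) = h (\<gamma> 0) + integral {0..t} (\<lambda>t. h (X t)))"
    if h: "bounded_linear h" for h :: "complex^3^3 \<Rightarrow> 'b::euclidean_space"
  proof (intro conjI ballI)
    show "(\<lambda>t. h (X t)) integrable_on {0..1}"
      using integrable_linear[OF X(1) h] by (simp add: o_def)
    fix t :: real assume t: "t \<in> {0..1}"
    then have "X integrable_on {0..t}"
      using integrable_on_subinterval[OF X(1), of 0 t] by auto
    from integral_linear[OF this h] have "h (integral {0..t} X) = integral {0..t} (\<lambda>t. h (X t))"
      by (simp add: o_def)
    then show "h (\<gamma> t) = h (\<gamma> 0) + integral {0..t} (\<lambda>t. h (X t))"
      using X(2)[OF t] linear_add[OF bounded_linear.linear[OF h]] by metis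
  qed
  have XA: "X t $ 1 $ 1 = - (B t * cnj (Complex (u1 t) (u2 t)) / 2)" 
    and XE: "Re (X t $ 3 $ 3) = E t * u4 t" if "t \<in> {0..1}" for t
    using Xt[OF that] by (simp_all add: emb_nth)
  show ?thesis
  proof (rule that)
    show "continuous_on {0..1} A" "continuous_on {0..1} B" "continuous_on {0..1} E"
      unfolding A_def B_def E_def by (intro continuous_intros cont)+
    show "(cmod (A t))\<^sup>2 + (cmod (B t))\<^sup>2 = 1" "0 < E t" if "t \<in> {0..1}" for t
      using coord[OF that] by auto
    show "A 0 = 1" "A 1 = A1" "E 0 = 1" "E 1 = exp v1"
      using end0 end1 by (simp_all add: A_def E_def Id3_eq_grp grp_eq_emb emb_nth)
    show "(\<lambda>t. - (B t * cnj (Complex (u1 t) (u2 t)) / 2)) integrable_on {0..1}"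
      by (rule integrable_eq[OF conjunct1[OF tr[OF bl(1)]]]) (rule XA)
    show "(\<lambda>t. E t * u4 t) integrable_on {0..1}"
      by (rule integrable_eq[OF conjunct1[OF tr[OF bl(2)]]]) (rule XE)
    show "A t = A 0 + integral {0..t} (\<lambda>t. - (B t * cnj (Complex (u1 t) (u2 t)) / 2))" if t: "t \<in> {0..1}" for t
    proof -
      have "integral {0..t} (\<lambda>t. X t $ 1 $ 1) = integral {0..t} (\<lambda>t. - (B t * cnj (Complex (u1 t) (u2 t)) / 2))"
        by (rule Henstock_Kurzweil_Integration.integral_cong) (use XA t in auto)
      then show ?thesis
        using bspec[OF conjunct2[OF tr[OF bl(1)]] t] by (simp only: A_def[THEN fun_cong])
    qed
    show "E t = E 0 + integral {0..t} (\<lambda>t. E t * u4 t)" if t: "t \<in> {0..1}" for t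
    proof -
      have "integral {0..t} (\<lambda>t. Re (X t $ 3 $ 3)) = integral {0..t} (\<lambda>t. E t * u4 t)"
        by (rule Henstock_Kurzweil_Integration.integral_cong) (use XE t in auto)
      then show ?thesis
        using bspec[OF conjunct2[OF tr[OF bl(2)]] t] by (simp only: E_def[THEN fun_cong])
    qed
  qed
qed

text \<open>Two calibrations: \<open>ln\<close> along \<open>E\<close>, and \<open>disc_dist\<close>
  of \<open>\<rho> * A\<close> along \<open>A\<close>. Scaling by \<rho> < 1 keeps the argument in
  the open disc, where \<open>disc_dist\<close> is differentiable, although the curve starts on the
  unit circle.\<close>

lemma horizontal_lower_bounds:
  assumes hor: "horizontal \<gamma> u1 u4 u2" and end0: "\<gamma> 0 = Id3" and end1: "\<gamma> 1 = grp A1 B1 v1"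
  shows "\<bar>v1\<bar> \<le> integral {0..1} (\<lambda>t. \<bar>u4 t\<bar>)"
    and "0 < \<rho> \<Longrightarrow> \<rho> < 1 \<Longrightarrow> \<bar>disc_dist (of_real \<rho> * A1) - disc_dist (of_real \<rho>)\<bar> \<le>
           integral {0..1} (\<lambda>t. cmod (Complex (u1 t) (u2 t)))"
proof -
  obtain A B E where
    cont: "continuous_on {0..1} A" "continuous_on {0..1} B" "continuous_on {0..1} E"
    and AB: "\<And>t. t \<in> {0..1} \<Longrightarrow> (cmod (A t))\<^sup>2 + (cmod (B t))\<^sup>2 = 1"
    and E: "\<And>t. t \<in> {0..1} \<Longrightarrow> 0 < E t"
    and ends: "A 0 = 1" "A 1 = A1" "E 0 = 1" "E 1 = exp v1"
    and int: "(\<lambda>t. - (B t * cnj (Complex (u1 t) (u2 t)) / 2)) integrable_on {0..1}"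
      "(\<lambda>t. E t * u4 t) integrable_on {0..1}"
    and eqA: "\<And>t. t \<in> {0..1} \<Longrightarrow> A t = A 0 + integral {0..t} (\<lambda>t. - (B t * cnj (Complex (u1 t) (u2 t)) / 2))"
    and eqE: "\<And>t. t \<in> {0..1} \<Longrightarrow> E t = E 0 + integral {0..t} (\<lambda>t. E t * u4 t)"
  proof (rule horizontal_coordinates[OF assms], goal_cases)
    case (1 A B E)
    show ?case by (rule 1(1)[OF 1(2-)])
  qed
  have u: "u1 absolutely_integrable_on {0..1}" "u4 absolutely_integrable_on {0..1}"
    "u2 absolutely_integrable_on {0..1}"
    using hor unfolding horizontal_def by blast+
  have "\<bar>ln (E 1) - ln (E 0)\<bar> \<le> integral {0..1} (\<lambda>t. \<bar>u4 t\<bar>)"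
  proof (rule abs_diff_along_curve_le[OF eqE int(2), where k = E])
    show "(\<lambda>t. \<bar>u4 t\<bar>) integrable_on {0..1}"
      using u(2) by (simp add: absolutely_integrable_on_def)
    fix t :: real assume t: "t \<in> {0..1}"
    have "(ln has_derivative (\<lambda>h. inverse (E t) * h)) (at (E t))"
      using DERIV_ln[OF E[OF t]] by (simp add: has_field_derivative_def)
    moreover have "\<bar>inverse (E t) * h\<bar> \<le> inverse (E t) * norm h" for h
      using E[OF t] by (simp add: abs_mult)
    ultimately show "\<exists>D K. (ln has_derivative D) (at (E t)) \<and> 0 \<le> K \<and>
        (\<forall>h. \<bar>D h\<bar> \<le> K * norm h) \<and> K * E t \<le> 1"
      using E[OF t] by (intro exI[of _ "\<lambda>h. inverse (E t) * h"] exI[of _ "inverse (E t)"]) auto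
  qed (use E cont in \<open>auto simp: abs_mult less_imp_le\<close>)
  then show "\<bar>v1\<bar> \<le> integral {0..1} (\<lambda>t. \<bar>u4 t\<bar>)" using ends by simp
  assume \<rho>: "0 < \<rho>" "\<rho> < 1"
  have "\<bar>disc_dist (of_real \<rho> * A 1) - disc_dist (of_real \<rho> * A 0)\<bar> \<le>
           integral {0..1} (\<lambda>t. cmod (Complex (u1 t) (u2 t)))"
  proof (rule abs_diff_along_curve_le[OF eqA int(1), where k = "\<lambda>t. cmod (B t) / 2"])
    show "(\<lambda>t. cmod (Complex (u1 t) (u2 t))) integrable_on {0..1}"
      using absolutely_integrable_control_norms u by blast
    show "continuous_on {0..1} (\<lambda>t. cmod (B t) / 2)" by (intro continuous_intros cont) auto
    show "cmod (- (B t * cnj (Complex (u1 t) (u2 t)) / 2)) \<le> cmod (B t) / 2 * cmod (Complex (u1 t) (u2 t))" for t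
      by (simp add: norm_mult norm_divide del: complex_cnj)
    fix t :: real assume t: "t \<in> {0..1}"
    have A1: "(cmod (A t))\<^sup>2 \<le> 1" using AB[OF t] by (smt (verit) zero_le_power2)
    then have c1: "cmod (A t) \<le> 1" by (simp add: abs_square_le_1)
    then have "\<rho> * cmod (A t) < 1" using \<rho> by (smt (verit) mult_less_cancel_left2 mult_left_le)
    then have cA: "cmod (of_real \<rho> * A t) < 1" using \<rho> by (simp add: norm_mult)
    obtain D where D: "(disc_dist has_derivative D) (at (of_real \<rho> * A t))"
      "\<And>k. \<bar>D k\<bar> \<le> 2 / sqrt (1 - (cmod (of_real \<rho> * A t))\<^sup>2) * cmod k"
      using has_derivative_disc_dist[OF cA] by metis
    define K where "K = 2 / sqrt (1 - (cmod (of_real \<rho> * A t))\<^sup>2) * \<rho>"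
    have p: "0 < 1 - (cmod (of_real \<rho> * A t))\<^sup>2" using cA by (simp add: abs_square_less_1)
    show "\<exists>D K. ((\<lambda>x. disc_dist (of_real \<rho> * x)) has_derivative D) (at (A t)) \<and> 0 \<le> K \<and>
        (\<forall>h. \<bar>D h\<bar> \<le> K * cmod h) \<and> K * (cmod (B t) / 2) \<le> 1"
    proof (intro exI conjI allI)
      show "((\<lambda>x. disc_dist (of_real \<rho> * x)) has_derivative (\<lambda>h. D (of_real \<rho> * h))) (at (A t))"
        by (rule has_derivative_compose[where f = "\<lambda>x. of_real \<rho> * x" and g = disc_dist, OF _ D(1)]) (auto intro!: derivative_eq_intros)
      show "0 \<le> K" using p \<rho> by (simp add: K_def)
      show "\<bar>D (of_real \<rho> * h)\<bar> \<le> K * cmod h" for h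
        using D(2)[of "of_real \<rho> * h"] \<rho> by (simp add: K_def norm_mult[of "of_real \<rho>" h] mult.assoc)
      \<comment> \<open>Scaling errs in the favourable direction: |B|^2 = 1 - |A|^2 is at most 1 -
        \<rho>^2 |A|^2, the quantity in the eikonal bound.\<close>
      have "(cmod (B t))\<^sup>2 \<le> 1 - (cmod (of_real \<rho> * A t))\<^sup>2"
      proof -
        have "\<rho>\<^sup>2 * (cmod (A t))\<^sup>2 \<le> (cmod (A t))\<^sup>2"
          using \<rho> by (simp add: mult_left_le_one_le power_le_one)
        then show ?thesis using AB[OF t] by (simp add: norm_mult power_mult_distrib)
      qed
      then have "cmod (B t) \<le> sqrt (1 - (cmod (of_real \<rho> * A t))\<^sup>2)" by (rule real_le_rsqrt)
      then have "\<rho> * cmod (B t) \<le> 1 * sqrt (1 - (cmod (of_real \<rho> * A t))\<^sup>2)" 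
        using \<rho> by (intro mult_mono) auto
      then show "K * (cmod (B t) / 2) \<le> 1"
        using p by (simp add: K_def field_simps)
    qed
  qed auto
  then show "\<bar>disc_dist (of_real \<rho> * A1) - disc_dist (of_real \<rho>)\<bar> \<le>
           integral {0..1} (\<lambda>t. cmod (Complex (u1 t) (u2 t)))"
    using ends by simp
qed

section \<open>From component bounds to the length\<close>

lemma hlength_nonneg: "0 \<le> hlength u1 u4 u2"
  unfolding hlength_def
  by (cases "(\<lambda>t. sqrt ((u1 t)\<^sup>2 + (u4 t)\<^sup>2 + (u2 t)\<^sup>2)) integrable_on {0..1}")
     (auto intro!: integral_nonneg simp: not_integrable_integral)

text \<open>Pair the constant vector (|v|, L) with (|u4|, |w|), where w = u1 + i u2. The integral of
  the pairing is at least R^2 = v^2 + L^2, while pointwise Cauchy-Schwarz bounds it by R times the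
  length. Dividing by R requires R > 0.\<close>

lemma hlength_lower_bound:
  assumes hor: "horizontal \<gamma> u1 u4 u2"
    and L: "0 \<le> L" "L \<le> integral {0..1} (\<lambda>t. cmod (Complex (u1 t) (u2 t)))"
    and v: "\<bar>v\<bar> \<le> integral {0..1} (\<lambda>t. \<bar>u4 t\<bar>)"
  shows "sqrt (v\<^sup>2 + L\<^sup>2) \<le> hlength u1 u4 u2"
proof (cases "v\<^sup>2 + L\<^sup>2 = 0")
  case True
  then show ?thesis using hlength_nonneg by simp
next
  case False
  define R where "R = sqrt (v\<^sup>2 + L\<^sup>2)"
  have R: "0 < R" "R\<^sup>2 = v\<^sup>2 + L\<^sup>2" 
    using False by (auto simp: R_def add_nonneg_eq_0_iff sum_power2_gt_zero_iff)
  have u: "u1 absolutely_integrable_on {0..1}" "u4 absolutely_integrable_on {0..1}"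
    "u2 absolutely_integrable_on {0..1}"
    using hor unfolding horizontal_def by blast+
  note n = absolutely_integrable_control_norms[OF u]
  have a: "(\<lambda>t. \<bar>u4 t\<bar>) integrable_on {0..1}"
    using u(2) by (simp add: absolutely_integrable_on_def)
  have "R\<^sup>2 = \<bar>v\<bar> * \<bar>v\<bar> + L * L" using R by (simp add: power2_eq_square)
  also have "\<dots> \<le> \<bar>v\<bar> * integral {0..1} (\<lambda>t. \<bar>u4 t\<bar>) + L * integral {0..1} (\<lambda>t. cmod (Complex (u1 t) (u2 t)))"
    using L v by (intro add_mono mult_left_mono) auto
  also have "\<dots> = integral {0..1} (\<lambda>t. \<bar>v\<bar> * \<bar>u4 t\<bar> + L * cmod (Complex (u1 t) (u2 t)))"
    using n a by (simp add: Henstock_Kurzweil_Integration.integral_add integrable_on_mult_right)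
  also have "\<dots> \<le> integral {0..1} (\<lambda>t. R * sqrt ((u1 t)\<^sup>2 + (u4 t)\<^sup>2 + (u2 t)\<^sup>2))"
  proof (rule integral_le)
    show "(\<lambda>t. \<bar>v\<bar> * \<bar>u4 t\<bar> + L * cmod (Complex (u1 t) (u2 t))) integrable_on {0..1}"
      "(\<lambda>t. R * sqrt ((u1 t)\<^sup>2 + (u4 t)\<^sup>2 + (u2 t)\<^sup>2)) integrable_on {0..1}"
      using n a by (auto intro!: integrable_add integrable_on_mult_right)
    fix t
    define w where "w = cmod (Complex (u1 t) (u2 t))"
    have "(\<bar>v\<bar> * \<bar>u4 t\<bar> + L * w)\<^sup>2 \<le> (v\<^sup>2 + L\<^sup>2) * ((u4 t)\<^sup>2 + w\<^sup>2)"
    proof -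
      have "(v\<^sup>2 + L\<^sup>2) * ((u4 t)\<^sup>2 + w\<^sup>2) - (\<bar>v\<bar> * \<bar>u4 t\<bar> + L * w)\<^sup>2 = (\<bar>v\<bar> * w - L * \<bar>u4 t\<bar>)\<^sup>2"
        by (simp add: power2_eq_square algebra_simps flip: abs_mult)
      then show ?thesis by (smt (verit) zero_le_power2)
    qed
    also have "\<dots> = (v\<^sup>2 + L\<^sup>2) * ((u1 t)\<^sup>2 + (u4 t)\<^sup>2 + (u2 t)\<^sup>2)"
      by (simp add: w_def cmod_power2)
    finally have "\<bar>v\<bar> * \<bar>u4 t\<bar> + L * w \<le> sqrt ((v\<^sup>2 + L\<^sup>2) * ((u1 t)\<^sup>2 + (u4 t)\<^sup>2 + (u2 t)\<^sup>2))"
      by (rule real_le_rsqrt)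
    then show "\<bar>v\<bar> * \<bar>u4 t\<bar> + L * cmod (Complex (u1 t) (u2 t)) \<le> R * sqrt ((u1 t)\<^sup>2 + (u4 t)\<^sup>2 + (u2 t)\<^sup>2)"
      by (simp add: R_def w_def real_sqrt_mult)
  qed
  also have "\<dots> = R * hlength u1 u4 u2" by (simp add: hlength_def)
  finally have "R \<le> hlength u1 u4 u2" using R(1) by (simp add: power2_eq_square)
  then show ?thesis by (simp add: R_def)
qed

section \<open>The distance to a point on a geodesic\<close>

lemma d2_le_hlength:
  assumes "horizontal \<gamma> u1 u4 u2"
  shows "d2 (\<gamma> 0) (\<gamma> 1) \<le> hlength u1 u4 u2"
  unfolding d2_def
proof (rule cInf_lower)
  show "bdd_below {hlength u1 u4 u2 |\<gamma>' u1 u4 u2. horizontal \<gamma>' u1 u4 u2 \<and> \<gamma>' 0 = \<gamma> 0 \<and> \<gamma>' 1 = \<gamma> 1}"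
    using hlength_nonneg by (intro bdd_belowI[of _ 0]) auto
  show "hlength u1 u4 u2 \<in> {hlength u1 u4 u2 |\<gamma>' u1 u4 u2. horizontal \<gamma>' u1 u4 u2 \<and> \<gamma>' 0 = \<gamma> 0 \<and> \<gamma>' 1 = \<gamma> 1}"
    using assms by (intro CollectI exI[of _ \<gamma>] exI conjI) auto
qed

text \<open>The given curve guarantees that the infimum is taken over a nonempty set of
  lengths.\<close>

lemma d2_ge:
  assumes "horizontal \<gamma> u1 u4 u2" "\<gamma> 0 = p" "\<gamma> 1 = q"
    and "\<And>\<gamma> u1 u4 u2. horizontal \<gamma> u1 u4 u2 \<Longrightarrow> \<gamma> 0 = p \<Longrightarrow> \<gamma> 1 = q \<Longrightarrow> R \<le> hlength u1 u4 u2"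
  shows "R \<le> d2 p q"
  unfolding d2_def
proof (rule cInf_greatest)
  have "hlength u1 u4 u2 \<in> {hlength u1 u4 u2 |\<gamma> u1 u4 u2. horizontal \<gamma> u1 u4 u2 \<and> \<gamma> 0 = p \<and> \<gamma> 1 = q}"
    using assms(1-3) by (intro CollectI exI[of _ \<gamma>] exI conjI) auto
  then show "{hlength u1 u4 u2 |\<gamma> u1 u4 u2. horizontal \<gamma> u1 u4 u2 \<and> \<gamma> 0 = p \<and> \<gamma> 1 = q} \<noteq> {}"
    by (metis empty_iff)
next
  fix x assume "x \<in> {hlength u1 u4 u2 |\<gamma> u1 u4 u2. horizontal \<gamma> u1 u4 u2 \<and> \<gamma> 0 = p \<and> \<gamma> 1 = q}"
  then obtain \<gamma> u1 u4 u2 where "horizontal \<gamma> u1 u4 u2" "\<gamma> 0 = p" "\<gamma> 1 = q" "x = hlength u1 u4 u2"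
    by (elim CollectE exE conjE)
  then show "R \<le> x" using assms(4) by metis
qed

section \<open>Explicit curves attaining the bound\<close>

lemma geo_0 [simp]: "geo \<sigma> 0 = 1"
  by (simp add: geo_def complex_eq_iff)

text \<open>The control u1 + i u2 has constant modulus and turns at the constant rate 2 \<sigma> s,
  with u4 = v constant, so the speed is constant. The shift \<psi> rotates \<open>B\<close> without
  changing \<open>A\<close>, which allows any phase of \<open>B\<close> at the endpoint.\<close>

lemma geodesic_horizontal:
  assumes \<sigma>: "\<bar>\<sigma>\<bar> \<le> 1" and s: "0 \<le> s"
  obtains \<gamma> u1 u4 u2 where "horizontal \<gamma> u1 u4 u2" "\<gamma> 0 = Id3"
    "\<gamma> 1 = grp (geo \<sigma> s) (of_real (sqrt (1 - \<sigma>\<^sup>2) * sin s) * cis (\<sigma> * s + \<psi>)) v"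
    "hlength u1 u4 u2 = sqrt (v\<^sup>2 + (2 * s * sqrt (1 - \<sigma>\<^sup>2))\<^sup>2)"
proof -
  define r where "r = sqrt (1 - \<sigma>\<^sup>2)"
  have r: "r * r = 1 - \<sigma> * \<sigma>" using \<sigma> by (simp add: r_def abs_square_le_1 power2_eq_square[symmetric])
  define A where "A = (\<lambda>t. geo \<sigma> (s * t))"
  define B where "B = (\<lambda>t. of_real (r * sin (s * t)) * cis (\<sigma> * (s * t) + \<psi>))"
  define \<gamma> where "\<gamma> = (\<lambda>t. grp (A t) (B t) (v * t))"
  define u1 where "u1 = (\<lambda>t. 2 * s * r * cos (2 * (\<sigma> * (s * t)) + \<psi>))"
  define u2 where "u2 = (\<lambda>t. 2 * s * r * sin (2 * (\<sigma> * (s * t)) + \<psi>))"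
  have w: "Complex (u1 t) (u2 t) = of_real (2 * s * r) * cis (2 * (\<sigma> * (s * t)) + \<psi>)" for t
    by (simp add: u1_def u2_def complex_eq_iff)
  have BA: "- (B t * cnj (Complex (u1 t) (u2 t)) / 2) = of_real (- (s * (1 - \<sigma> * \<sigma>) * sin (s * t))) * cis (- (\<sigma> * (s * t)))" for t
  proof -
    have "- (B t * cnj (Complex (u1 t) (u2 t)) / 2) = 
       - (of_real (s * (r * r) * sin (s * t)) * (cis (\<sigma> * (s * t) + \<psi>) * cis (- (2 * (\<sigma> * (s * t)) + \<psi>))))"
      unfolding w B_def by (simp add: cis_cnj algebra_simps)
    then show ?thesis unfolding r cis_mult by (simp add: algebra_simps)
  qed
  have AB: "A t * Complex (u1 t) (u2 t) / 2 = of_real (s * r) * Complex (cos (s * t)) (\<sigma> * sin (s * t)) * cis (\<sigma> * (s * t) + \<psi>)" for t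
  proof -
    have "A t * Complex (u1 t) (u2 t) / 2 = 
       of_real (s * r) * Complex (cos (s * t)) (\<sigma> * sin (s * t)) * (cis (- (\<sigma> * (s * t))) * cis (2 * (\<sigma> * (s * t)) + \<psi>))"
      unfolding w A_def geo_def by (simp add: algebra_simps)
    then show ?thesis unfolding cis_mult by (simp add: algebra_simps)
  qed
  have dA: "(A has_vector_derivative - (B t * cnj (Complex (u1 t) (u2 t)) / 2)) (at t within S)" for t S
    unfolding BA A_def geo_def has_vector_derivative_complex_iff
    by (auto intro!: derivative_eq_intros simp: algebra_simps)
  have dB: "(B has_vector_derivative A t * Complex (u1 t) (u2 t) / 2) (at t within S)" for t S
    unfolding AB unfolding B_def has_vector_derivative_complex_iff
    by (auto intro!: derivative_eq_intros simp: algebra_simps)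
  have dE: "((\<lambda>t. of_real (exp (v * t))) has_vector_derivative of_real (exp (v * t)) * of_real v) (at t within S)"
    for t S
    unfolding has_vector_derivative_complex_iff by (auto intro!: derivative_eq_intros)
  have d\<gamma>: "(\<gamma> has_vector_derivative \<gamma> t ** ctrl (u1 t) v (u2 t)) (at t within S)" for t S
    unfolding \<gamma>_def grp_eq_emb emb_mult_ctrl
    by (intro bounded_linear.has_vector_derivative[OF linear_emb[unfolded linear_conv_bounded_linear]]
        has_vector_derivative_Pair dA dB dE)
  have int: "((\<lambda>s. \<gamma> s ** ctrl (u1 s) v (u2 s)) has_integral \<gamma> t - \<gamma> 0) {0..t}" if "0 \<le> t" for t
    by (rule fundamental_theorem_of_calculus[OF that]) (rule d\<gamma>)
  have norm: "(cmod (A t))\<^sup>2 + (cmod (B t))\<^sup>2 = 1" for t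
  proof -
    have "(cmod (B t))\<^sup>2 = (1 - \<sigma>\<^sup>2) * (sin (s * t))\<^sup>2"
      using r by (simp add: B_def norm_mult power_mult_distrib power2_eq_square[of r] power2_eq_square[of \<sigma>])
    then show ?thesis by (simp add: A_def cmod_geo)
  qed
  have hor: "horizontal \<gamma> u1 (\<lambda>_. v) u2"
    unfolding horizontal_def
  proof (intro conjI ballI)
    show "continuous_on {0..1} \<gamma>"
      unfolding continuous_on_eq_continuous_within
      by (intro ballI has_vector_derivative_continuous[OF d\<gamma>])
    show "\<gamma> t \<in> SU2R" for t unfolding SU2R_def \<gamma>_def using norm by blast
    show "u1 absolutely_integrable_on {0..1}" "u2 absolutely_integrable_on {0..1}"
      unfolding u1_def u2_def by (intro absolutely_integrable_continuous_real continuous_intros)+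
    show "(\<lambda>_::real. v) absolutely_integrable_on {0..1}"
      by (intro absolutely_integrable_continuous_real continuous_intros)
    show "(\<lambda>s. \<gamma> s ** ctrl (u1 s) v (u2 s)) integrable_on {0..1}"
      using int[of 1] by (auto simp: integrable_on_def)
    show "\<gamma> t = \<gamma> 0 + integral {0..t} (\<lambda>s. \<gamma> s ** ctrl (u1 s) v (u2 s))" if "t \<in> {0..1}" for t
      using integral_unique[OF int[of t]] that by simp
  qed
  have sq: "(u1 t)\<^sup>2 + v\<^sup>2 + (u2 t)\<^sup>2 = v\<^sup>2 + (2 * s * r)\<^sup>2" for t
  proof -
    have "(u1 t)\<^sup>2 + (u2 t)\<^sup>2 = (2 * s * r)\<^sup>2 * ((cos (2 * (\<sigma> * (s * t)) + \<psi>))\<^sup>2 + (sin (2 * (\<sigma> * (s * t)) + \<psi>))\<^sup>2)"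
      by (simp only: u1_def u2_def power_mult_distrib distrib_left)
    then show ?thesis by simp
  qed
  have len: "hlength u1 (\<lambda>_. v) u2 = sqrt (v\<^sup>2 + (2 * s * r)\<^sup>2)"
    unfolding hlength_def sq by simp
  show ?thesis
    by (rule that[OF hor])
       (use len in \<open>simp_all add: \<gamma>_def A_def B_def Id3_eq_grp r_def\<close>)
qed

section \<open>Approach to the boundary circle\<close>

definition radii :: "nat \<Rightarrow> real" where
  "radii n = 1 - inverse (real n + 2)"

lemma radii_bounds: "0 < radii n" "radii n < 1"
  by (simp_all add: radii_def field_simps)

lemma radii_tendsto: "radii \<longlonglongrightarrow> 1"
proof -
  have "(\<lambda>n. inverse (real (Suc (Suc n)))) \<longlonglongrightarrow> 0"
    using LIMSEQ_inverse_real_of_nat LIMSEQ_Suc by blast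
  then have "(\<lambda>n. 1 - inverse (real (Suc (Suc n)))) \<longlonglongrightarrow> 1 - 0"
    by (intro tendsto_intros)
  then show ?thesis by (simp add: radii_def[abs_def] add.commute)
qed

text \<open>\<open>twist\<close> fixes the points of the real axis inside the disc, so
  \<open>disc_dist\<close> equals 2 arccos along these radii: the calibration vanishes in the limit
  at the starting point A = 1.\<close>

lemma disc_dist_radii_tendsto_0: "(\<lambda>n. disc_dist (of_real (radii n))) \<longlonglongrightarrow> 0"
proof -
  have "disc_dist (of_real (radii n)) = 2 * arccos (radii n)" for n
  proof -
    have t: "twist (of_real (radii n)) = of_real (radii n)" by (simp add: twist_def)
    have "1 - (radii n)\<^sup>2 > 0" using radii_bounds[of n] by (simp add: abs_square_less_1)
    then show ?thesis
      using disc_dist_twist[of "of_real (radii n)"] radii_bounds[of n] by (simp add: t arccos_ratio_def)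
  qed
  moreover have "(\<lambda>n. arccos (radii n)) \<longlonglongrightarrow> arccos 1"
  proof (rule continuous_on_tendsto_compose[OF continuous_on_arccos' radii_tendsto])
    have "radii n \<in> {-1..1}" for n using radii_bounds[of n] by simp
    then show "\<forall>\<^sub>F n in sequentially. radii n \<in> {-1..1}" by simp
  qed simp
  ultimately show ?thesis using tendsto_mult_right_zero by auto
qed

lemma tendsto_geo:
  assumes "(f \<longlongrightarrow> \<sigma>) F" "(g \<longlongrightarrow> s) F"
  shows "((\<lambda>n. geo (f n) (g n)) \<longlongrightarrow> geo \<sigma> s) F"
proof -
  note isCont_tendsto_compose[OF isCont_cos assms(2)] isCont_tendsto_compose[OF isCont_sin assms(2)]
  then show ?thesis unfolding geo_def by (intro tendsto_intros assms)
qed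

lemma geo_pi: "geo \<sigma> pi = - cis (- (\<sigma> * pi))"
  by (simp add: geo_def complex_eq_iff)

text \<open>For |\<sigma>| < 1 the angle - \<sigma> pi lies inside the principal branch, so
  \<open>Arg\<close> recovers it from \<open>geo \<sigma> pi\<close>.\<close>

lemma geo_pi_inj:
  assumes "\<bar>\<sigma>\<bar> < 1" "\<bar>\<sigma>'\<bar> < 1" "geo \<sigma> pi = geo \<sigma>' pi"
  shows "\<sigma> = \<sigma>'"
proof -
  have b: "- pi < - (x * pi)" "- (x * pi) \<le> pi" if "\<bar>x\<bar> < 1" for x
  proof -
    have "-1 < x" "x < 1" using that by auto
    then show "- pi < - (x * pi)" "- (x * pi) \<le> pi"
      using mult_strict_right_mono[of x 1 pi] mult_strict_right_mono[of "-1" x pi] by auto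
  qed
  have "Arg (cis (- (x * pi))) = - (x * pi)" if "\<bar>x\<bar> < 1" for x
    by (rule cis_Arg_unique[OF sgn_cis b[OF that]])
  from this[OF assms(1)] this[OF assms(2)] have "- (\<sigma> * pi) = - (\<sigma>' * pi)"
    using assms(3) unfolding geo_pi by (metis add.inverse_inverse)
  then show ?thesis by simp
qed

text \<open>Modulus 1 means (1 - \<sigma>^2) (sin s)^2 = 0. For \<sigma> = 1 or -1 the two rotations
  in \<open>geo\<close> cancel, and s = 0 is the starting point; both give the excluded value 1,
  leaving s = pi.\<close>

lemma geo_boundary:
  assumes "cmod (geo \<sigma> s) = 1" "geo \<sigma> s \<noteq> 1" "\<bar>\<sigma>\<bar> \<le> 1" "0 \<le> s" "s \<le> pi"
  shows "s = pi" "\<bar>\<sigma>\<bar> < 1"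
proof -
  have "(1 - \<sigma>\<^sup>2) * (sin s)\<^sup>2 = 0" using cmod_geo[of \<sigma> s] assms by simp
  moreover have "\<bar>\<sigma>\<bar> \<noteq> 1"
  proof
    assume "\<bar>\<sigma>\<bar> = 1"
    then have "\<sigma> = 1 \<or> \<sigma> = -1" by linarith
    then have "geo \<sigma> s = 1"
      using sin_cos_squared_add[of s] by (auto simp: geo_def complex_eq_iff power2_eq_square)
    then show False using assms by simp
  qed
  ultimately have "sin s = 0" using power2_eq_1_iff[of \<sigma>] by auto
  moreover have "s \<noteq> 0" using assms(2) by (auto simp: geo_def complex_eq_iff)
  ultimately show "s = pi" using sin_gt_zero[of s] assms by force
  show "\<bar>\<sigma>\<bar> < 1" using assms(3) \<open>\<bar>\<sigma>\<bar> \<noteq> 1\<close> by simp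
qed

text \<open>On the boundary circle the preimage under \<open>geo\<close> is found by compactness: a limit point of the
  parameters of \<open>radii n * A\<close> lies on the side \<open>s = pi\<close>, because the other three sides of the
  parameter rectangle are collapsed to \<open>A = 1\<close>.\<close>

lemma disc_dist_radial_subseq:
  assumes \<sigma>: "\<bar>\<sigma>\<bar> < 1" and s: "0 < s" "s \<le> pi"
  obtains r :: "nat \<Rightarrow> nat" where "strict_mono r"
    "(\<lambda>n. disc_dist (of_real (radii (r n)) * geo \<sigma> s)) \<longlonglongrightarrow> 2 * s * sqrt (1 - \<sigma>\<^sup>2)"
proof (cases "s < pi")
  case True
  \<comment> \<open>Inside the disc continuity suffices, and the identity serves as the
    subsequence.\<close>
  have "isCont disc_dist (geo \<sigma> s)"
    using has_derivative_disc_dist[OF cmod_geo_less_1[OF \<sigma> s(1) True]] has_derivative_continuous by metis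
  moreover have "(\<lambda>n. of_real (radii n) * geo \<sigma> s) \<longlonglongrightarrow> of_real 1 * geo \<sigma> s"
    by (intro tendsto_intros radii_tendsto)
  ultimately have "(\<lambda>n. disc_dist (of_real (radii n) * geo \<sigma> s)) \<longlonglongrightarrow> disc_dist (geo \<sigma> s)"
    using isCont_tendsto_compose by fastforce
  then show ?thesis
    using that[of id] disc_dist_geo[OF \<sigma> s(1) True] by (simp add: strict_mono_def)
next
  case False
  then have s: "s = pi" using s by simp
  define A where "A = geo \<sigma> pi"
  have A1: "cmod A = 1" by (simp add: A_def geo_pi)
  have "\<exists>p. \<bar>fst p\<bar> < 1 \<and> 0 < snd p \<and> snd p < pi \<and> of_real (radii n) * A = geo (fst p) (snd p)" for n
  proof -
    have "cmod (of_real (radii n) * A) < 1" using radii_bounds[of n] A1 by (simp add: norm_mult)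
    from geo_surj[OF this] show ?thesis by (metis fst_conv snd_conv)
  qed
  then obtain p where p: "\<And>n. \<bar>fst (p n)\<bar> < 1" "\<And>n. 0 < snd (p n)" "\<And>n. snd (p n) < pi"
    "\<And>n. of_real (radii n) * A = geo (fst (p n)) (snd (p n))" by metis
  have "compact ({-1..1::real} \<times> {0..pi})" by (intro compact_Times compact_Icc)
  moreover have "\<forall>n. p n \<in> {-1..1} \<times> {0..pi}"
    using p(1-3) by (auto simp: mem_Times_iff abs_less_iff less_imp_le)
  ultimately obtain l r where l: "l \<in> {-1..1} \<times> {0..pi}" "strict_mono (r::nat \<Rightarrow> nat)" "(p \<circ> r) \<longlonglongrightarrow> l"
    unfolding compact_def by metis
  have lim: "(\<lambda>n. fst (p (r n))) \<longlonglongrightarrow> fst l" "(\<lambda>n. snd (p (r n))) \<longlonglongrightarrow> snd l"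
    using tendsto_fst[OF l(3)] tendsto_snd[OF l(3)] by (simp_all add: o_def)
  have "(\<lambda>n. of_real (radii (r n)) * A) \<longlonglongrightarrow> geo (fst l) (snd l)"
    unfolding p(4) by (rule tendsto_geo[OF lim])
  moreover have "(\<lambda>n. of_real (radii (r n)) * A) \<longlonglongrightarrow> of_real 1 * A"
    using LIMSEQ_subseq_LIMSEQ[OF radii_tendsto l(2)] by (intro tendsto_intros) (simp add: o_def)
  ultimately have gl: "geo (fst l) (snd l) = A"
    using LIMSEQ_unique by fastforce
  \<comment> \<open>A = 1 would force - \<sigma> pi = pi within the principal branch, against
    |\<sigma>| < 1. Hence the limit parameters avoid the collapsed sides.\<close>
  have "A \<noteq> 1"
  proof
    assume "A = 1"
    then have "geo \<sigma> pi = - cis pi" by (simp add: A_def)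
    then have "cis (- (\<sigma> * pi)) = cis pi" by (metis add.inverse_inverse geo_pi)
    moreover have "-1 < \<sigma>" "\<sigma> < 1" using \<sigma> by auto
    ultimately have "- (\<sigma> * pi) = pi"
      using cis_Arg_unique[of "cis pi" "- (\<sigma> * pi)"] cis_Arg_unique[of "cis pi" pi]
        mult_strict_right_mono[of \<sigma> 1 pi] mult_strict_right_mono[of "-1" \<sigma> pi] by auto
    then have "(\<sigma> + 1) * pi = 0" by (simp add: algebra_simps)
    then show False using \<sigma> by simp
  qed
  then have b: "snd l = pi" "\<bar>fst l\<bar> < 1"
    using geo_boundary[of "fst l" "snd l"] gl A1 l(1) by (auto simp: mem_Times_iff abs_le_iff)
  then have "fst l = \<sigma>" using geo_pi_inj[of "fst l" \<sigma>] gl \<sigma> by (simp add: A_def)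
  moreover have "(\<lambda>n. 2 * snd (p (r n)) * sqrt (1 - (fst (p (r n)))\<^sup>2)) \<longlonglongrightarrow> 2 * snd l * sqrt (1 - (fst l)\<^sup>2)"
    by (intro tendsto_intros lim)
  ultimately show ?thesis
    using that[OF l(2)] disc_dist_geo[OF p(1-3)] b s by (simp add: A_def[symmetric] p(4))
qed

section \<open>The distance in geodesic parameters\<close>

lemma control_length_ge_geo:
  assumes hor: "horizontal \<gamma> u1 u4 u2" and ends: "\<gamma> 0 = Id3" "\<gamma> 1 = grp (geo \<sigma> s) B v"
    and \<sigma>: "\<bar>\<sigma>\<bar> < 1" and s: "0 < s" "s \<le> pi"
  shows "2 * s * sqrt (1 - \<sigma>\<^sup>2) \<le> integral {0..1} (\<lambda>t. cmod (Complex (u1 t) (u2 t)))"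
proof -
  obtain r :: "nat \<Rightarrow> nat" where r: "strict_mono r"
    "(\<lambda>n. disc_dist (of_real (radii (r n)) * geo \<sigma> s)) \<longlonglongrightarrow> 2 * s * sqrt (1 - \<sigma>\<^sup>2)"
    using disc_dist_radial_subseq[OF \<sigma> s] by blast
  \<comment> \<open>Along the subsequence the calibration tends to 0 at the start of the curve and
    to the geodesic length at its end.\<close>
  have "(\<lambda>n. disc_dist (of_real (radii (r n)) * geo \<sigma> s) - disc_dist (of_real (radii (r n))))
      \<longlonglongrightarrow> 2 * s * sqrt (1 - \<sigma>\<^sup>2) - 0"
    using LIMSEQ_subseq_LIMSEQ[OF disc_dist_radii_tendsto_0 r(1)] r(2) by (intro tendsto_diff) (simp_all add: o_def)
  then show ?thesis
    using horizontal_lower_bounds(2)[OF hor ends radii_bounds]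
    by (intro LIMSEQ_le_const2[of _ "2 * s * sqrt (1 - \<sigma>\<^sup>2)"]) (auto simp: abs_le_iff)
qed

lemma d2_geo:
  assumes \<sigma>: "\<bar>\<sigma>\<bar> < 1" and s: "0 < s" "s \<le> pi"
    and g: "(cmod (geo \<sigma> s))\<^sup>2 + (cmod B)\<^sup>2 = 1"
  shows "d2 Id3 (grp (geo \<sigma> s) B v) = sqrt (v\<^sup>2 + (2 * s * sqrt (1 - \<sigma>\<^sup>2))\<^sup>2)"
proof -
  have p: "0 \<le> 1 - \<sigma>\<^sup>2" using \<sigma> by (simp add: abs_square_le_1)
  have e: "(cmod B)\<^sup>2 = (sqrt (1 - \<sigma>\<^sup>2) * sin s)\<^sup>2"
    using g p by (simp add: cmod_geo power_mult_distrib)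
  have "cmod B = sqrt (1 - \<sigma>\<^sup>2) * sin s"
    by (rule power2_eq_imp_eq[OF e]) (use p s sin_ge_zero[of s] in auto)
  \<comment> \<open>The modulus of \<open>B\<close> is dictated by that of \<open>A\<close>; the
    shift \<open>Arg B - \<sigma> * s\<close> then makes the geodesic end at \<open>B\<close>
    itself.\<close>
  then have B: "of_real (sqrt (1 - \<sigma>\<^sup>2) * sin s) * cis (\<sigma> * s + (Arg B - \<sigma> * s)) = B"
    using rcis_cmod_Arg[of B] by (simp add: rcis_def)
  obtain \<gamma> u1 u4 u2 where \<gamma>: "horizontal \<gamma> u1 u4 u2" "\<gamma> 0 = Id3" "\<gamma> 1 = grp (geo \<sigma> s) B v"
    "hlength u1 u4 u2 = sqrt (v\<^sup>2 + (2 * s * sqrt (1 - \<sigma>\<^sup>2))\<^sup>2)"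
  proof (rule geodesic_horizontal[of \<sigma> s "Arg B - \<sigma> * s" v], goal_cases)
    case (3 \<gamma> u1 u4 u2)
    show ?case by (rule 3(1)[OF 3(2,3) 3(4)[unfolded B] 3(5)])
  qed (use \<sigma> s in simp_all)
  show ?thesis
  proof (rule antisym)
    show "d2 Id3 (grp (geo \<sigma> s) B v) \<le> sqrt (v\<^sup>2 + (2 * s * sqrt (1 - \<sigma>\<^sup>2))\<^sup>2)"
      using d2_le_hlength[OF \<gamma>(1)] \<gamma> by simp
    show "sqrt (v\<^sup>2 + (2 * s * sqrt (1 - \<sigma>\<^sup>2))\<^sup>2) \<le> d2 Id3 (grp (geo \<sigma> s) B v)"
    proof (rule d2_ge[OF \<gamma>(1-3)])
      fix \<gamma> u1 u4 u2
      assume h: "horizontal \<gamma> u1 u4 u2" "\<gamma> 0 = Id3" "\<gamma> 1 = grp (geo \<sigma> s) B v"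
      show "sqrt (v\<^sup>2 + (2 * s * sqrt (1 - \<sigma>\<^sup>2))\<^sup>2) \<le> hlength u1 u4 u2"
        by (rule hlength_lower_bound[OF h(1) _ control_length_ge_geo[OF h \<sigma> s] horizontal_lower_bounds(1)[OF h]])
          (use p s in simp)
    qed
  qed
qed

text \<open>A = 1 is not a value of \<open>geo\<close> for |\<sigma>| < 1 and 0 < s \<le> pi. The
  geodesic with s = 0 moves only in the real factor, and the lower bound is used with L = 0.\<close>

lemma d2_grp_1: "d2 Id3 (grp 1 0 v) = \<bar>v\<bar>"
proof -
  obtain \<gamma> u1 u4 u2 where \<gamma>: "horizontal \<gamma> u1 u4 u2" "\<gamma> 0 = Id3" "\<gamma> 1 = grp 1 0 v"
    "hlength u1 u4 u2 = \<bar>v\<bar>"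
  proof (rule geodesic_horizontal[of 0 0 0 v], goal_cases)
    case (3 \<gamma> u1 u4 u2)
    show ?case by (rule 3(1)[of \<gamma> u1 u4 u2]) (use 3(2-) in \<open>simp_all\<close>)
  qed simp_all
  show ?thesis
  proof (rule antisym)
    show "d2 Id3 (grp 1 0 v) \<le> \<bar>v\<bar>" using d2_le_hlength[OF \<gamma>(1)] \<gamma> by simp
    show "\<bar>v\<bar> \<le> d2 Id3 (grp 1 0 v)"
    proof (rule d2_ge[OF \<gamma>(1-3)])
      fix \<gamma> u1 u4 u2 assume h: "horizontal \<gamma> u1 u4 u2" "\<gamma> 0 = Id3" "\<gamma> 1 = grp 1 0 v"
      have "0 \<le> integral {0..1} (\<lambda>t. cmod (Complex (u1 t) (u2 t)))"
        by (rule order_trans[OF abs_ge_zero horizontal_lower_bounds(2)[OF h radii_bounds[of 0]]])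
      then show "\<bar>v\<bar> \<le> hlength u1 u4 u2"
        using hlength_lower_bound[OF h(1), of 0 v] horizontal_lower_bounds(1)[OF h] by simp
    qed
  qed
qed

section \<open>Solving for the geodesic\<close>

lemma Re_geo_phase:
  assumes \<sigma>: "\<bar>\<sigma>\<bar> < 1" and s: "0 < s" "s < pi" and a: "a = cmod (geo \<sigma> s)" "0 < a"
  obtains \<eta> where "0 \<le> \<eta>" "\<eta> \<le> pi" "cos s = a * cos \<eta>" "Re (geo \<sigma> s) = a * cos (phase a \<eta>)"
proof -
  define z where "z = Complex (cos s) (\<sigma> * sin s)"
  have cz: "cmod z = a" using a by (simp add: z_def cmod_geo_Complex)
  have z: "z = rcis a (Arg z)" using cz rcis_cmod_Arg[of z] by simp
  have "geo \<sigma> s = twist z" using geo_eq_twist[OF s] by (simp add: z_def)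
  also have "\<dots> = rcis a (phase a (Arg z))" using twist_rcis z by metis
  finally have g: "Re (geo \<sigma> s) = a * cos (phase a (Arg z))" by simp
  have "cos s = Re z" by (simp add: z_def)
  also have "\<dots> = a * cos (Arg z)" using arg_cong[OF z, of Re] by simp
  finally have c: "cos s = a * cos (Arg z)" .
  \<comment> \<open>\<open>phase a\<close> is odd and cos is even, so Arg z may be replaced by its
    absolute value, which lies where cos is decreasing.\<close>
  show ?thesis
  proof (rule that[of "\<bar>Arg z\<bar>"])
    show "\<bar>Arg z\<bar> \<le> pi" using Arg_bounded[of z] by auto
    show "cos s = a * cos \<bar>Arg z\<bar>" using c by simp
    show "Re (geo \<sigma> s) = a * cos (phase a \<bar>Arg z\<bar>)"
      using g by (cases "0 \<le> Arg z") (simp_all add: phase_minus)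
  qed simp
qed

lemma phase_half_pi: "phase a (pi / 2) = pi / 2 - pi / 2 * a"
  by (simp add: phase_def arccos_ratio_def)

text \<open>In the untwisted disc s = pi / 2 is the imaginary axis, at polar angle pi / 2 up to
  sign. By \<open>phase_half_pi\<close> it is carried to the angle with cosine sin (pi a / 2), which
  explains the threshold; monotonicity of \<open>phase\<close> and of cos on [0, pi] does the
  rest.\<close>

lemma Re_geo_compare:
  assumes \<sigma>: "\<bar>\<sigma>\<bar> < 1" and s: "0 < s" "s < pi" and a: "a = cmod (geo \<sigma> s)" "0 < a"
  shows "s < pi / 2 \<Longrightarrow> Re (geo \<sigma> s) > a * sin (pi / 2 * a)"
    and "s = pi / 2 \<Longrightarrow> Re (geo \<sigma> s) = a * sin (pi / 2 * a)"
    and "s > pi / 2 \<Longrightarrow> Re (geo \<sigma> s) < a * sin (pi / 2 * a)"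
proof -
  obtain \<eta> where \<eta>: "0 \<le> \<eta>" "\<eta> \<le> pi" "cos s = a * cos \<eta>" "Re (geo \<sigma> s) = a * cos (phase a \<eta>)"
    using Re_geo_phase[OF assms] by blast
  have a1: "a < 1" using cmod_geo_less_1[OF \<sigma> s] a by simp
  have m: "phase a x < phase a y" if "x < y" for x y
    using phase_strict_mono[of a x y] a(2) a1 that by simp
  have r: "0 \<le> phase a x" "phase a x \<le> pi" if "0 \<le> x" "x \<le> pi" for x
    using m[of 0 x] m[of x pi] that by (cases "x = 0"; cases "x = pi"; simp)+
  have sin: "sin (pi / 2 * a) = cos (phase a (pi / 2))"
    by (simp add: phase_half_pi sin_cos_eq)
  { assume "s < pi / 2"
    then have "0 < cos \<eta>" using cos_gt_zero[of s] s \<eta>(3) a(2) by (simp add: zero_less_mult_iff)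
    then have "\<eta> < pi / 2" using cos_monotone_0_pi_le[of "pi/2" \<eta>] \<eta> by (cases "\<eta> < pi / 2") auto
    then have "cos (phase a (pi / 2)) < cos (phase a \<eta>)"
      using m r \<eta> by (intro cos_monotone_0_pi) auto
    then show "Re (geo \<sigma> s) > a * sin (pi / 2 * a)" unfolding sin \<eta>(4) using a(2) by simp }
  { assume "s > pi / 2"
    then have "cos s < 0" using cos_monotone_0_pi[of "pi/2" s] s by simp
    then have "cos \<eta> < 0" using \<eta>(3) a(2) by (simp add: mult_less_0_iff)
    then have "pi / 2 < \<eta>" using cos_monotone_0_pi_le[of \<eta> "pi/2"] \<eta> by (cases "pi / 2 < \<eta>") auto
    then have "cos (phase a \<eta>) < cos (phase a (pi / 2))"
      using m r \<eta> by (intro cos_monotone_0_pi) auto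
    then show "Re (geo \<sigma> s) < a * sin (pi / 2 * a)" unfolding sin \<eta>(4) using a(2) by simp }
  { assume "s = pi / 2"
    then have "a * cos \<eta> = 0" using \<eta>(3) cos_pi_half by metis
    then have "cos \<eta> = cos (pi / 2)" using a(2) by simp
    then have "\<eta> = pi / 2" using cos_inj_pi[of \<eta> "pi/2"] \<eta> by simp
    then show "Re (geo \<sigma> s) = a * sin (pi / 2 * a)" unfolding sin \<eta>(4) by (simp only:) }
qed

section \<open>Passage from \<sigma> to \<xi>\<close>

definition slope :: "real \<Rightarrow> real" where
  "slope \<xi> = \<xi> / sqrt (1 + \<xi>\<^sup>2)"

lemma one_plus_square_pos: "0 < 1 + (\<xi>::real)\<^sup>2"
  by (smt (verit) zero_le_power2)

lemma slope_props:
  shows "\<bar>slope \<xi>\<bar> < 1" "1 - (slope \<xi>)\<^sup>2 = 1 / (1 + \<xi>\<^sup>2)"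
proof -
  show e: "1 - (slope \<xi>)\<^sup>2 = 1 / (1 + \<xi>\<^sup>2)"
    using one_plus_square_pos[of \<xi>] by (simp add: slope_def power_divide field_simps)
  have "0 < 1 / (1 + \<xi>\<^sup>2)" using one_plus_square_pos[of \<xi>] by simp
  then have "(slope \<xi>)\<^sup>2 < 1" using e by linarith
  then show "\<bar>slope \<xi>\<bar> < 1" by (simp add: abs_square_less_1)
qed

lemma slope_surj:
  assumes "\<bar>\<sigma>\<bar> < 1"
  obtains \<xi> where "slope \<xi> = \<sigma>" "1 + \<xi>\<^sup>2 = 1 / (1 - \<sigma>\<^sup>2)"
proof (rule that)
  have p: "0 < 1 - \<sigma>\<^sup>2" using assms by (simp add: abs_square_less_1)
  show e: "1 + (\<sigma> / sqrt (1 - \<sigma>\<^sup>2))\<^sup>2 = 1 / (1 - \<sigma>\<^sup>2)"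
    using p by (simp add: power_divide field_simps)
  show "slope (\<sigma> / sqrt (1 - \<sigma>\<^sup>2)) = \<sigma>"
    unfolding slope_def e using p by (simp add: real_sqrt_divide)
qed

lemma slope_inj:
  assumes "slope \<xi> = slope \<xi>'"
  shows "\<xi> = \<xi>'"
proof -
  have "1 / (1 + \<xi>\<^sup>2) = 1 / (1 + \<xi>'\<^sup>2)" using slope_props(2) assms by metis
  then have "1 + \<xi>\<^sup>2 = 1 + \<xi>'\<^sup>2" by (metis inverse_eq_divide inverse_eq_iff_eq)
  then show ?thesis using assms one_plus_square_pos[of \<xi>'] unfolding slope_def by simp
qed

text \<open>For \<sigma> = \<open>slope \<xi>\<close>, modulus a means (sin s)^2 = (1 - a^2) (1 +
  \<xi>^2), with solutions s = \<open>S\<close> and s = pi - \<open>S\<close>. At \<open>S\<close>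
  the number cos s + i \<sigma> sin s has argument \<open>\<beta>\<close>; at pi - \<open>S\<close>
  it is reflected in the imaginary axis.\<close>

lemma geo_slope:
  assumes a: "0 < a" "a < 1" and \<xi>: "(1 - a\<^sup>2) * (1 + \<xi>\<^sup>2) \<le> 1"
  defines "S \<equiv> arcsin (sqrt ((1 - a\<^sup>2) * (1 + \<xi>\<^sup>2)))"
    and "\<beta> \<equiv> arcsin (\<xi> * sqrt (1 - a\<^sup>2) / a)"
  shows "0 < S" "S \<le> pi / 2"
    "geo (slope \<xi>) S = of_real a * cis (- slope \<xi> * S + \<beta>)"
    "geo (slope \<xi>) (pi - S) = - (of_real a * cis (- (slope \<xi> * (pi - S) + \<beta>)))"
proof -
  have p: "0 < 1 - a\<^sup>2" using a by (simp add: abs_square_less_1)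
  have q: "0 < 1 + \<xi>\<^sup>2" by (rule one_plus_square_pos)
  define X where "X = sqrt ((1 - a\<^sup>2) * (1 + \<xi>\<^sup>2))"
  have X: "0 < X" "-1 \<le> X" "X \<le> 1" "X\<^sup>2 = (1 - a\<^sup>2) * (1 + \<xi>\<^sup>2)"
  proof -
    show "0 < X" "X \<le> 1" "X\<^sup>2 = (1 - a\<^sup>2) * (1 + \<xi>\<^sup>2)" using p q \<xi> by (auto simp: X_def)
    then show "-1 \<le> X" by linarith
  qed
  have SX: "S = arcsin X" by (simp add: S_def X_def)
  have sinS: "sin S = sqrt ((1 - a\<^sup>2) * (1 + \<xi>\<^sup>2))" unfolding SX using X by (simp add: X_def)
  show S: "0 < S" "S \<le> pi / 2"
    unfolding SX using X arcsin_less_arcsin[of 0 X] arcsin_bounded[of X] by auto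
  have cosS: "cos S = sqrt (1 - (1 - a\<^sup>2) * (1 + \<xi>\<^sup>2))"
    unfolding SX X(4)[symmetric] by (rule cos_arcsin) (use X in auto)
  \<comment> \<open>This identity shows that the second arcsine is within its domain exactly when
    the first one is.\<close>
  have x2: "(\<xi> * sqrt (1 - a\<^sup>2) / a)\<^sup>2 = 1 - (1 - (1 - a\<^sup>2) * (1 + \<xi>\<^sup>2)) / a\<^sup>2"
    using p a by (simp add: power_divide power_mult_distrib field_simps)
  have "(\<xi> * sqrt (1 - a\<^sup>2) / a)\<^sup>2 \<le> 1" unfolding x2 using \<xi> by simp
  then have x1: "- 1 \<le> \<xi> * sqrt (1 - a\<^sup>2) / a" "\<xi> * sqrt (1 - a\<^sup>2) / a \<le> 1"
    by (simp_all only: abs_square_le_1 abs_le_iff) auto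
  have sinb: "a * sin \<beta> = slope \<xi> * sin S"
  proof -
    have "a * sin \<beta> = \<xi> * sqrt (1 - a\<^sup>2)" unfolding \<beta>_def using x1 a by (subst sin_arcsin) auto
    also have "\<dots> = slope \<xi> * sin S" unfolding slope_def sinS real_sqrt_mult using q by simp
    finally show ?thesis .
  qed
  have cosb: "a * cos \<beta> = cos S"
  proof -
    have "cos \<beta> = sqrt ((1 - (1 - a\<^sup>2) * (1 + \<xi>\<^sup>2)) / a\<^sup>2)"
      unfolding \<beta>_def cos_arcsin[OF x1] x2 by simp
    then show ?thesis using a unfolding cosS by (simp add: real_sqrt_divide)
  qed
  have c: "Complex (cos S) (slope \<xi> * sin S) = of_real a * cis \<beta>"
    using sinb cosb by (simp add: complex_eq_iff)
  have "geo (slope \<xi>) S = of_real a * (cis (- (slope \<xi> * S)) * cis \<beta>)"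
    unfolding geo_def c by simp
  then show "geo (slope \<xi>) S = of_real a * cis (- slope \<xi> * S + \<beta>)"
    unfolding cis_mult by simp
  have d: "Complex (cos (pi - S)) (slope \<xi> * sin (pi - S)) = - (of_real a * cis (- \<beta>))"
    using sinb cosb by (simp add: complex_eq_iff)
  have "geo (slope \<xi>) (pi - S) = - (of_real a * (cis (- (slope \<xi> * (pi - S))) * cis (- \<beta>)))"
    unfolding geo_def d by simp
  then show "geo (slope \<xi>) (pi - S) = - (of_real a * cis (- (slope \<xi> * (pi - S) + \<beta>)))"
    unfolding cis_mult by simp
qed

text \<open>The converse of \<open>geo_slope\<close>: the radicand is (sin s)^2, and arcsin (sin s)
  returns s or pi - s according to the side of pi / 2. This separates the last two cases of the
  theorem.\<close>

lemma slope_of_geo: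
  assumes \<sigma>: "\<bar>\<sigma>\<bar> < 1" and s: "0 < s" "s < pi" and a: "a = cmod (geo \<sigma> s)"
  obtains \<xi> where "slope \<xi> = \<sigma>" "(1 - a\<^sup>2) * (1 + \<xi>\<^sup>2) \<le> 1"
    "arcsin (sqrt ((1 - a\<^sup>2) * (1 + \<xi>\<^sup>2))) = (if s \<le> pi / 2 then s else pi - s)"
proof -
  obtain \<xi> where \<xi>: "slope \<xi> = \<sigma>" "1 + \<xi>\<^sup>2 = 1 / (1 - \<sigma>\<^sup>2)" using slope_surj[OF \<sigma>] by blast
  have p: "0 < 1 - \<sigma>\<^sup>2" using \<sigma> by (simp add: abs_square_less_1)
  have e: "(1 - a\<^sup>2) * (1 + \<xi>\<^sup>2) = (sin s)\<^sup>2"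
    unfolding a cmod_geo \<xi>(2) using p by simp
  have sp: "0 \<le> sin s" using s by (intro sin_ge_zero) auto
  have "arcsin (sin s) = (if s \<le> pi / 2 then s else pi - s)"
    using s arcsin_sin[of s] arcsin_sin[of "pi - s"] by auto
  then show ?thesis
    using that[OF \<xi>(1)] sp unfolding e by (simp add: abs_square_le_1)
qed

text \<open>The trigonometric systems are polar forms of the endpoint equation. In the second, - a
  cis (- \<theta>) differs from a cis \<theta> only in the sign of the real part, hence the minus
  before Re A.\<close>

lemma geo_slope_eq_iff:
  assumes a: "0 < a" "a < 1" and \<xi>: "(1 - a\<^sup>2) * (1 + \<xi>\<^sup>2) \<le> 1"
  defines "S \<equiv> arcsin (sqrt ((1 - a\<^sup>2) * (1 + \<xi>\<^sup>2)))"
    and "\<beta> \<equiv> arcsin (\<xi> * sqrt (1 - a\<^sup>2) / a)"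
  shows "geo (slope \<xi>) S = A \<longleftrightarrow>
      cos (- \<xi> / sqrt (1 + \<xi>\<^sup>2) * S + \<beta>) = Re A / a \<and> sin (- \<xi> / sqrt (1 + \<xi>\<^sup>2) * S + \<beta>) = Im A / a"
    and "geo (slope \<xi>) (pi - S) = A \<longleftrightarrow>
      cos (\<xi> / sqrt (1 + \<xi>\<^sup>2) * (pi - S) + \<beta>) = - Re A / a \<and>
      sin (\<xi> / sqrt (1 + \<xi>\<^sup>2) * (pi - S) + \<beta>) = Im A / a"
proof -
  have "of_real a * cis \<theta> = A \<longleftrightarrow> cos \<theta> = Re A / a \<and> sin \<theta> = Im A / a" for \<theta>
    using a by (auto simp: complex_eq_iff field_simps)
  moreover have "- \<xi> / sqrt (1 + \<xi>\<^sup>2) * S = - slope \<xi> * S" by (simp add: slope_def)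
  ultimately show "geo (slope \<xi>) S = A \<longleftrightarrow>
      cos (- \<xi> / sqrt (1 + \<xi>\<^sup>2) * S + \<beta>) = Re A / a \<and> sin (- \<xi> / sqrt (1 + \<xi>\<^sup>2) * S + \<beta>) = Im A / a"
    using geo_slope(3)[OF a \<xi>] by (simp only: S_def \<beta>_def)
  have "- (of_real a * cis (- \<theta>)) = A \<longleftrightarrow> cos \<theta> = - Re A / a \<and> sin \<theta> = Im A / a" for \<theta>
    using a by (auto simp: complex_eq_iff field_simps)
  then show "geo (slope \<xi>) (pi - S) = A \<longleftrightarrow>
      cos (\<xi> / sqrt (1 + \<xi>\<^sup>2) * (pi - S) + \<beta>) = - Re A / a \<and>
      sin (\<xi> / sqrt (1 + \<xi>\<^sup>2) * (pi - S) + \<beta>) = Im A / a"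
    using geo_slope(4)[OF a \<xi>] by (simp only: S_def \<beta>_def slope_def)
qed

lemma d2_geo_slope:
  assumes g: "(cmod A)\<^sup>2 + (cmod B)\<^sup>2 = 1" and s: "0 < s" "s \<le> pi" and A: "geo (slope \<xi>) s = A"
  shows "d2 Id3 (grp A B v) = sqrt (v\<^sup>2 + 4 / (1 + \<xi>\<^sup>2) * s\<^sup>2)"
proof -
  have "(2 * s * sqrt (1 - (slope \<xi>)\<^sup>2))\<^sup>2 = 4 / (1 + \<xi>\<^sup>2) * s\<^sup>2"
    unfolding slope_props(2) using one_plus_square_pos[of \<xi>] by (simp add: power_mult_distrib real_sqrt_divide power_divide)
  then show ?thesis
    using d2_geo[OF slope_props(1) s, of \<xi> B v] g A by simp
qed

text \<open>In the last two cases \<open>sys\<close> includes the domain condition of both arcsines,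
  since \<open>arcsin\<close> is total but meaningless outside [-1, 1]. Existence and uniqueness of
  \<xi> are those of the geodesic through \<open>A\<close>, taken with s < pi / 2 and s > pi / 2
  respectively.\<close>

theorem theorem6:
  fixes A B :: complex and v :: real
  assumes hg: "(cmod A)\<^sup>2 + (cmod B)\<^sup>2 = 1"
  shows
   "(A = 0 \<longrightarrow> d2 Id3 (grp A B v) = sqrt (v\<^sup>2 + pi\<^sup>2))
  \<and> (cmod A = 1 \<longrightarrow>
       d2 Id3 (grp A B v) = sqrt (v\<^sup>2 + 4 * \<bar>Arg A\<bar> * (2 * pi - \<bar>Arg A\<bar>)))
  \<and> (0 < cmod A \<and> cmod A < 1 \<and> Re A = cmod A * sin (pi / 2 * cmod A) \<longrightarrow>
       d2 Id3 (grp A B v) = sqrt (v\<^sup>2 + pi\<^sup>2 * (1 - (cmod A)\<^sup>2)))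
  \<and> (0 < cmod A \<and> cmod A < 1 \<and> Re A > cmod A * sin (pi / 2 * cmod A) \<longrightarrow>
       (let a = cmod A;
            S = (\<lambda>\<xi>::real. arcsin (sqrt ((1 - a\<^sup>2) * (1 + \<xi>\<^sup>2))));
            \<theta> = (\<lambda>\<xi>::real. - \<xi> / sqrt (1 + \<xi>\<^sup>2) * S \<xi>
                          + arcsin (\<xi> * sqrt (1 - a\<^sup>2) / a));
            sys = (\<lambda>\<xi>::real. (1 - a\<^sup>2) * (1 + \<xi>\<^sup>2) \<le> 1
                          \<and> cos (\<theta> \<xi>) = Re A / a \<and> sin (\<theta> \<xi>) = Im A / a)
        in (\<exists>!\<xi>. sys \<xi>) \<and>
           (\<forall>\<xi>. sys \<xi> \<longrightarrow>
              d2 Id3 (grp A B v) = sqrt (v\<^sup>2 + 4 / (1 + \<xi>\<^sup>2) * (S \<xi>)\<^sup>2))))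
  \<and> (0 < cmod A \<and> cmod A < 1 \<and> Re A < cmod A * sin (pi / 2 * cmod A) \<longrightarrow>
       (let a = cmod A;
            S = (\<lambda>\<xi>::real. arcsin (sqrt ((1 - a\<^sup>2) * (1 + \<xi>\<^sup>2))));
            \<theta> = (\<lambda>\<xi>::real. \<xi> / sqrt (1 + \<xi>\<^sup>2) * (pi - S \<xi>)
                          + arcsin (\<xi> * sqrt (1 - a\<^sup>2) / a));
            sys = (\<lambda>\<xi>::real. (1 - a\<^sup>2) * (1 + \<xi>\<^sup>2) \<le> 1
                          \<and> cos (\<theta> \<xi>) = - Re A / a \<and> sin (\<theta> \<xi>) = Im A / a)
        in (\<exists>!\<xi>. sys \<xi>) \<and>
           (\<forall>\<xi>. sys \<xi> \<longrightarrow>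
              d2 Id3 (grp A B v) = sqrt (v\<^sup>2 + 4 / (1 + \<xi>\<^sup>2) * (pi - S \<xi>)\<^sup>2))))"
proof (intro conjI impI)
  assume "A = 0"
  \<comment> \<open>The centre is reached along the straight geodesic, \<sigma> = 0.\<close>
  moreover have "geo 0 (pi / 2) = 0" by (simp add: geo_def complex_eq_iff)
  ultimately show "d2 Id3 (grp A B v) = sqrt (v\<^sup>2 + pi\<^sup>2)"
    using d2_geo[of 0 "pi / 2" B v] hg by simp
next
  assume A1: "cmod A = 1"
  then have B: "B = 0" using hg by simp
  have A: "A = cis (Arg A)" using rcis_cmod_Arg[of A] A1 by (simp add: rcis_def)
  show "d2 Id3 (grp A B v) = sqrt (v\<^sup>2 + 4 * \<bar>Arg A\<bar> * (2 * pi - \<bar>Arg A\<bar>))"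
  proof (cases "Arg A = 0")
    case True
    then have "A = 1" using A by simp
    then show ?thesis using d2_grp_1[of v] B by simp
  next
    case False
    have b: "- pi < Arg A" "Arg A \<le> pi" using Arg_bounded[of A] by auto
    \<comment> \<open>Solves - cis (- \<sigma> pi) = cis (Arg A): \<sigma> pi equals pi - Arg A
      modulo 2 pi, and the sign of Arg A selects the representative with |\<sigma>| < 1.\<close>
    define \<sigma> where "\<sigma> = (if 0 < Arg A then 1 - Arg A / pi else - 1 - Arg A / pi)"
    have \<sigma>1: "\<bar>\<sigma>\<bar> = 1 - \<bar>Arg A\<bar> / pi"
      using b False by (auto simp: \<sigma>_def abs_if field_simps)
    have "0 < \<bar>Arg A\<bar> / pi" using False by simp
    then have \<sigma>: "\<bar>\<sigma>\<bar> < 1" using \<sigma>1 by linarith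
    have "\<sigma> * pi = (if 0 < Arg A then pi - Arg A else - pi - Arg A)"
      by (simp add: \<sigma>_def algebra_simps)
    then have "geo \<sigma> pi = cis (Arg A)"
      by (simp add: geo_pi complex_eq_iff cos_diff sin_diff)
    then have g: "geo \<sigma> pi = A" using A by simp
    have "1 - \<sigma>\<^sup>2 = 1 - \<bar>\<sigma>\<bar>\<^sup>2" by simp
    also have "\<dots> = \<bar>Arg A\<bar> / pi * (2 - \<bar>Arg A\<bar> / pi)"
      unfolding \<sigma>1 by (simp add: power2_eq_square algebra_simps)
    finally have "4 * pi\<^sup>2 * (1 - \<sigma>\<^sup>2) = 4 * \<bar>Arg A\<bar> * (2 * pi - \<bar>Arg A\<bar>)"
      by (simp add: power2_eq_square field_simps)
    moreover have "0 \<le> 1 - \<sigma>\<^sup>2" using \<sigma> by (simp add: abs_square_le_1)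
    ultimately have "(2 * pi * sqrt (1 - \<sigma>\<^sup>2))\<^sup>2 = 4 * \<bar>Arg A\<bar> * (2 * pi - \<bar>Arg A\<bar>)"
      by (simp add: power_mult_distrib)
    then show ?thesis using d2_geo[OF \<sigma>, of pi B v] g hg by simp
  qed
next
  assume h: "0 < cmod A \<and> cmod A < 1 \<and> Re A = cmod A * sin (pi / 2 * cmod A)"
  obtain \<sigma> s where g: "\<bar>\<sigma>\<bar> < 1" "0 < s" "s < pi" "A = geo \<sigma> s" using geo_surj h by blast
  \<comment> \<open>Each position of s relative to pi / 2 gives a different comparison with the
    threshold, so the hypothesis determines it.\<close>
  have s: "s = pi / 2"
    using Re_geo_compare[OF g(1-3) refl] h g(4)
    by (cases s "pi / 2" rule: linorder_cases) auto
  have "1 - (cmod A)\<^sup>2 = 1 - \<sigma>\<^sup>2" unfolding g(4) s cmod_geo by simp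
  moreover have "0 \<le> 1 - \<sigma>\<^sup>2" using g by (simp add: abs_square_le_1)
  ultimately have "(2 * s * sqrt (1 - \<sigma>\<^sup>2))\<^sup>2 = pi\<^sup>2 * (1 - (cmod A)\<^sup>2)"
    by (simp add: power_mult_distrib s power2_eq_square[of pi])
  then show "d2 Id3 (grp A B v) = sqrt (v\<^sup>2 + pi\<^sup>2 * (1 - (cmod A)\<^sup>2))"
    using d2_geo[OF g(1,2), of B v] g(3,4) hg by simp
next
  assume h: "0 < cmod A \<and> cmod A < 1 \<and> Re A > cmod A * sin (pi / 2 * cmod A)"
  define a where "a = cmod A"
  have a: "0 < a" "a < 1" "a = cmod A" using h by (auto simp: a_def)
  define S where "S = (\<lambda>\<xi>. arcsin (sqrt ((1 - a\<^sup>2) * (1 + \<xi>\<^sup>2))))"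
  define P where "P = (\<lambda>\<xi>. (1 - a\<^sup>2) * (1 + \<xi>\<^sup>2) \<le> 1)"
  \<comment> \<open>The system becomes an endpoint equation, where uniqueness follows from
    injectivity of \<open>geo\<close> and \<open>slope\<close>.\<close>
  have sys: "(P \<xi> \<and> cos (- \<xi> / sqrt (1 + \<xi>\<^sup>2) * S \<xi> + arcsin (\<xi> * sqrt (1 - a\<^sup>2) / a)) = Re A / a \<and>
      sin (- \<xi> / sqrt (1 + \<xi>\<^sup>2) * S \<xi> + arcsin (\<xi> * sqrt (1 - a\<^sup>2) / a)) = Im A / a) \<longleftrightarrow>
      P \<xi> \<and> geo (slope \<xi>) (S \<xi>) = A" for \<xi>
    unfolding P_def S_def by (intro conj_cong refl geo_slope_eq_iff(1)[OF a(1,2), symmetric])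
  have S: "0 < S \<xi>" "S \<xi> \<le> pi / 2" if "P \<xi>" for \<xi>
    using geo_slope(1,2)[OF a(1,2)] that by (auto simp: P_def S_def)
  obtain \<sigma> s where g: "\<bar>\<sigma>\<bar> < 1" "0 < s" "s < pi" "A = geo \<sigma> s" using geo_surj h by blast
  have s: "s < pi / 2"
    using Re_geo_compare[OF g(1-3) refl] h g(4)
    by (cases s "pi / 2" rule: linorder_cases) auto
  obtain \<xi>0 where \<xi>0: "slope \<xi>0 = \<sigma>" "P \<xi>0" "S \<xi>0 = s"
    using slope_of_geo[OF g(1-3), of a] s a(3) g(4) by (auto simp: P_def S_def)
  have "\<exists>!\<xi>. P \<xi> \<and> geo (slope \<xi>) (S \<xi>) = A"
  proof (rule ex1I)
    show "P \<xi>0 \<and> geo (slope \<xi>0) (S \<xi>0) = A" using \<xi>0 g by simp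
    fix \<xi> assume x: "P \<xi> \<and> geo (slope \<xi>) (S \<xi>) = A"
    have "slope \<xi> = \<sigma>"
      by (rule geo_inj(1)[of _ "S \<xi>" _ s]) (use slope_props(1) S[of \<xi>] x g in auto)
    then show "\<xi> = \<xi>0" using slope_inj \<xi>0 by simp
  qed
  moreover have "d2 Id3 (grp A B v) = sqrt (v\<^sup>2 + 4 / (1 + \<xi>\<^sup>2) * (S \<xi>)\<^sup>2)"
    if "P \<xi> \<and> geo (slope \<xi>) (S \<xi>) = A" for \<xi>
    using d2_geo_slope[OF hg, of "S \<xi>"] S[of \<xi>] that by simp
  ultimately show "let a = cmod A;
            S = (\<lambda>\<xi>::real. arcsin (sqrt ((1 - a\<^sup>2) * (1 + \<xi>\<^sup>2))));
            \<theta> = (\<lambda>\<xi>::real. - \<xi> / sqrt (1 + \<xi>\<^sup>2) * S \<xi>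
                          + arcsin (\<xi> * sqrt (1 - a\<^sup>2) / a));
            sys = (\<lambda>\<xi>::real. (1 - a\<^sup>2) * (1 + \<xi>\<^sup>2) \<le> 1
                          \<and> cos (\<theta> \<xi>) = Re A / a \<and> sin (\<theta> \<xi>) = Im A / a)
        in (\<exists>!\<xi>. sys \<xi>) \<and>
           (\<forall>\<xi>. sys \<xi> \<longrightarrow>
              d2 Id3 (grp A B v) = sqrt (v\<^sup>2 + 4 / (1 + \<xi>\<^sup>2) * (S \<xi>)\<^sup>2))"
    unfolding sys[symmetric] unfolding Let_def a_def[symmetric] P_def S_def by blast
next
  assume h: "0 < cmod A \<and> cmod A < 1 \<and> Re A < cmod A * sin (pi / 2 * cmod A)"
  define a where "a = cmod A"
  have a: "0 < a" "a < 1" "a = cmod A" using h by (auto simp: a_def)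
  define S where "S = (\<lambda>\<xi>. arcsin (sqrt ((1 - a\<^sup>2) * (1 + \<xi>\<^sup>2))))"
  define P where "P = (\<lambda>\<xi>. (1 - a\<^sup>2) * (1 + \<xi>\<^sup>2) \<le> 1)"
  have sys: "(P \<xi> \<and> cos (\<xi> / sqrt (1 + \<xi>\<^sup>2) * (pi - S \<xi>) + arcsin (\<xi> * sqrt (1 - a\<^sup>2) / a)) = - Re A / a \<and>
      sin (\<xi> / sqrt (1 + \<xi>\<^sup>2) * (pi - S \<xi>) + arcsin (\<xi> * sqrt (1 - a\<^sup>2) / a)) = Im A / a) \<longleftrightarrow>
      P \<xi> \<and> geo (slope \<xi>) (pi - S \<xi>) = A" for \<xi>
    unfolding P_def S_def by (intro conj_cong refl geo_slope_eq_iff(2)[OF a(1,2), symmetric])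
  have S: "0 < pi - S \<xi>" "pi - S \<xi> < pi" if "P \<xi>" for \<xi>
    using geo_slope(1,2)[OF a(1,2), of \<xi>] that pi_gt_zero by (auto simp: P_def S_def)
  obtain \<sigma> s where g: "\<bar>\<sigma>\<bar> < 1" "0 < s" "s < pi" "A = geo \<sigma> s" using geo_surj h by blast
  have s: "pi / 2 < s"
    using Re_geo_compare[OF g(1-3) refl] h g(4)
    by (cases s "pi / 2" rule: linorder_cases) auto
  \<comment> \<open>Past pi / 2 the arcsine returns pi - s, so the parameter s is pi -
    \<open>S\<close>.\<close>
  obtain \<xi>0 where \<xi>0: "slope \<xi>0 = \<sigma>" "P \<xi>0" "S \<xi>0 = pi - s"
    using slope_of_geo[OF g(1-3), of a] s a(3) g(4) by (auto simp: P_def S_def)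
  have "\<exists>!\<xi>. P \<xi> \<and> geo (slope \<xi>) (pi - S \<xi>) = A"
  proof (rule ex1I)
    show "P \<xi>0 \<and> geo (slope \<xi>0) (pi - S \<xi>0) = A" using \<xi>0 g by simp
    fix \<xi> assume x: "P \<xi> \<and> geo (slope \<xi>) (pi - S \<xi>) = A"
    have "slope \<xi> = \<sigma>"
      by (rule geo_inj(1)[of _ "pi - S \<xi>" _ s]) (use slope_props(1) S[of \<xi>] x g in auto)
    then show "\<xi> = \<xi>0" using slope_inj \<xi>0 by simp
  qed
  moreover have "d2 Id3 (grp A B v) = sqrt (v\<^sup>2 + 4 / (1 + \<xi>\<^sup>2) * (pi - S \<xi>)\<^sup>2)"
    if "P \<xi> \<and> geo (slope \<xi>) (pi - S \<xi>) = A" for \<xi>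
    using d2_geo_slope[OF hg, of "pi - S \<xi>"] S[of \<xi>] that by simp
  ultimately show "let a = cmod A;
            S = (\<lambda>\<xi>::real. arcsin (sqrt ((1 - a\<^sup>2) * (1 + \<xi>\<^sup>2))));
            \<theta> = (\<lambda>\<xi>::real. \<xi> / sqrt (1 + \<xi>\<^sup>2) * (pi - S \<xi>)
                          + arcsin (\<xi> * sqrt (1 - a\<^sup>2) / a));
            sys = (\<lambda>\<xi>::real. (1 - a\<^sup>2) * (1 + \<xi>\<^sup>2) \<le> 1
                          \<and> cos (\<theta> \<xi>) = - Re A / a \<and> sin (\<theta> \<xi>) = Im A / a)
        in (\<exists>!\<xi>. sys \<xi>) \<and>
           (\<forall>\<xi>. sys \<xi> \<longrightarrow>
              d2 Id3 (grp A B v) = sqrt (v\<^sup>2 + 4 / (1 + \<xi>\<^sup>2) * (pi - S \<xi>)\<^sup>2))"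
    unfolding sys[symmetric] unfolding Let_def a_def[symmetric] P_def S_def by blast
qed

end
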